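(* Let $M^n=N_1^{2n_1+1}\times N_2^{2n_2+1}$ be the standard Hermitian manifold on the product of two Sasakian manifolds, of complex dimension $n=n_1+n_2+1\geq 2$. Then $M^n$ is Strominger Kähler-like (SKL) if and only if both $n_1\leq 1$ and $n_2\leq 1$.
   Context: A Sasakian manifold $(N^{2m+1},g,\xi)$ ($m\ge 0$) is a Riemannian manifold of dimension $2m+1$ with a unit-length Killing vector field $\xi$ such that: (1) for some constant $c>0$, the tensor $X\mapsto\frac1c\nabla_X\xi$ ($\nabla$ the Levi-Civita connection) gives an integrable orthogonal complex structure $J$ on the distribution $H=\xi^{\perp}\subset TN$; (2) the dual $1$-form $\alpha(X)=g(X,\xi)$ is a contact form, i.e. $\alpha\wedge(d\alpha)^m$ is nowhere zero. Given Sasakian manifolds $(N_i^{2n_i+1},g_i,\xi_i)$ with constants $c_i>0$ and distributions $H_i=\xi_i^\perp$, $i=1,2$, the standard Hermitian structure on the product is $(N_1\times N_2,g_1\times g_2,J)$ with $J\xi_1=\xi_2$ and $JX_i=\frac1{c_i}\nabla_{X_i}\xi_i$ for $X_i\in H_i$; this $J$ is integrable. For a Hermitian manifold $(M^n,g)$ with complex structure $J$, the Strominger (Bismut) connection $\nabla^s$ is the unique connection with $\nabla^s g=0$, $\nabla^s J=0$ whose torsion $T^s$ is totally skew-symmetric (i.e. $g(T^s(x,y),z)$ is a $3$-form). $(M,g)$ is Strominger Kähler-like (SKL) if the curvature tensor $R^s$ of $\nabla^s$ has all the symmetries of the curvature of a Kähler manifold: $R^s(x,y,z,w)+R^s(y,z,x,w)+R^s(z,x,y,w)=0$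 and $R^s(x,y,z,w)=R^s(Jx,Jy,z,w)=R^s(x,y,Jz,Jw)$ for all real tangent vectors $x,y,z,w$. *)

theory Defs
  imports "HOL-Analysis.Analysis"
begin

text \<open>
  Differential geometry in local coordinates.  A manifold is given by an indexed smooth atlas with
  charts onto open subsets of a Euclidean space \<open>'e\<close>.  A tensor field or an affine connection is
  the family of its coordinate expressions, one for each chart (a function of the coordinate point
  with values in the tensors on \<open>'e\<close>), subject to the usual transformation law under changes of
  coordinates.  Only the values at points of the chart images are meaningful.
\<close>

subsection \<open>Smooth maps and smooth manifolds\<close>

abbreviation ddir :: "('e::euclidean_space \<Rightarrow> 'f::real_normed_vector) \<Rightarrow> 'e \<Rightarrow> 'e \<Rightarrow> 'f"
  where "ddir f x u \<equiv> frechet_derivative f (at x) u"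

text \<open>\<open>Ck_on k S f\<close>: the map \<open>f\<close> is of class $C^k$ on the open set \<open>S\<close>.\<close>

fun Ck_on :: "nat \<Rightarrow> 'e::euclidean_space set \<Rightarrow> ('e \<Rightarrow> 'f::real_normed_vector) \<Rightarrow> bool" where
  "Ck_on 0 S f \<longleftrightarrow> continuous_on S f"
| "Ck_on (Suc k) S f \<longleftrightarrow>
     (\<forall>x\<in>S. f differentiable (at x)) \<and> (\<forall>u. Ck_on k S (\<lambda>x. ddir f x u))"

definition smooth_on :: "'e::euclidean_space set \<Rightarrow> ('e \<Rightarrow> 'f::real_normed_vector) \<Rightarrow> bool"
  where "smooth_on S f \<longleftrightarrow> (\<forall>k. Ck_on k S f)"

record ('i, 'a, 'e) atlas =
  charts :: "'i set"
  chart_dom :: "'i \<Rightarrow> 'a set"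
  chart_map :: "'i \<Rightarrow> 'a \<Rightarrow> 'e"

definition points :: "('i, 'a, 'e) atlas \<Rightarrow> 'a set"
  where "points M = (\<Union>i\<in>charts M. chart_dom M i)"

definition chart_img :: "('i, 'a, 'e) atlas \<Rightarrow> 'i \<Rightarrow> 'e set"
  where "chart_img M i = chart_map M i ` chart_dom M i"

definition chart_inv :: "('i, 'a, 'e) atlas \<Rightarrow> 'i \<Rightarrow> 'e \<Rightarrow> 'a"
  where "chart_inv M i = inv_into (chart_dom M i) (chart_map M i)"

definition overlap :: "('i, 'a, 'e) atlas \<Rightarrow> 'i \<Rightarrow> 'i \<Rightarrow> 'e set"
  where "overlap M i j = chart_map M i ` (chart_dom M i \<inter> chart_dom M j)"

definition trans_map :: "('i, 'a, 'e) atlas \<Rightarrow> 'i \<Rightarrow> 'i \<Rightarrow> 'e \<Rightarrow> 'e"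
  where "trans_map M i j = chart_map M j \<circ> chart_inv M i"

text \<open>
  The manifold is the set \<open>points M\<close>, an open subset of the ambient topological space \<open>'a\<close>; it is
  Hausdorff and second countable because of the sort of \<open>'a\<close>, and its dimension is \<open>DIM('e)\<close>.
\<close>

definition smooth_manifold ::
    "('i, 'a::{t2_space,second_countable_topology}, 'e::euclidean_space) atlas \<Rightarrow> bool"
  where "smooth_manifold M \<longleftrightarrow>
    points M \<noteq> {} \<and>
    (\<forall>i\<in>charts M. open (chart_dom M i) \<and> open (chart_img M i) \<and>
       homeomorphism (chart_dom M i) (chart_img M i) (chart_map M i) (chart_inv M i)) \<and>
    (\<forall>i\<in>charts M. \<forall>j\<in>charts M. smooth_on (overlap M i j) (trans_map M i j))"

subsection \<open>Tensor fields and connections\<close>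

type_synonym ('i, 'e) vec_field = "'i \<Rightarrow> 'e \<Rightarrow> 'e"
type_synonym ('i, 'e) endo_field = "'i \<Rightarrow> 'e \<Rightarrow> 'e \<Rightarrow> 'e"
type_synonym ('i, 'e) metric = "'i \<Rightarrow> 'e \<Rightarrow> 'e \<Rightarrow> 'e \<Rightarrow> real"
type_synonym ('i, 'e) connection = "'i \<Rightarrow> 'e \<Rightarrow> 'e \<Rightarrow> 'e \<Rightarrow> 'e"

definition vector_field ::
    "('i, 'a, 'e::euclidean_space) atlas \<Rightarrow> ('i, 'e) vec_field \<Rightarrow> bool"
  where "vector_field M X \<longleftrightarrow>
    (\<forall>i\<in>charts M. smooth_on (chart_img M i) (X i)) \<and>
    (\<forall>i\<in>charts M. \<forall>j\<in>charts M. \<forall>x\<in>overlap M i j.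
       X j (trans_map M i j x) = ddir (trans_map M i j) x (X i x))"

definition endomorphism_field ::
    "('i, 'a, 'e::euclidean_space) atlas \<Rightarrow> ('i, 'e) endo_field \<Rightarrow> bool"
  where "endomorphism_field M A \<longleftrightarrow>
    (\<forall>i\<in>charts M. \<forall>x\<in>chart_img M i. linear (A i x)) \<and>
    (\<forall>i\<in>charts M. \<forall>u. smooth_on (chart_img M i) (\<lambda>x. A i x u)) \<and>
    (\<forall>i\<in>charts M. \<forall>j\<in>charts M. \<forall>x\<in>overlap M i j. \<forall>u.
       A j (trans_map M i j x) (ddir (trans_map M i j) x u) =
       ddir (trans_map M i j) x (A i x u))"

definition riemannian_metric ::
    "('i, 'a, 'e::euclidean_space) atlas \<Rightarrow> ('i, 'e) metric \<Rightarrow> bool"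
  where "riemannian_metric M g \<longleftrightarrow>
    (\<forall>i\<in>charts M. \<forall>x\<in>chart_img M i. bilinear (g i x) \<and>
       (\<forall>u v. g i x u v = g i x v u) \<and> (\<forall>u. u \<noteq> 0 \<longrightarrow> g i x u u > 0)) \<and>
    (\<forall>i\<in>charts M. \<forall>u v. smooth_on (chart_img M i) (\<lambda>x. g i x u v)) \<and>
    (\<forall>i\<in>charts M. \<forall>j\<in>charts M. \<forall>x\<in>overlap M i j. \<forall>u v.
       g j (trans_map M i j x) (ddir (trans_map M i j) x u) (ddir (trans_map M i j) x v) =
       g i x u v)"

text \<open>
  A connection is given by its Christoffel symbols \<open>D i x u v\<close>; the covariant derivative is
  \<open>\<nabla>\<^sub>X Y = dY(X) + D(X, Y)\<close>.  The transformation law says that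
  this does not depend on the coordinates.
\<close>

definition affine_connection ::
    "('i, 'a, 'e::euclidean_space) atlas \<Rightarrow> ('i, 'e) connection \<Rightarrow> bool"
  where "affine_connection M D \<longleftrightarrow>
    (\<forall>i\<in>charts M. \<forall>x\<in>chart_img M i. bilinear (D i x)) \<and>
    (\<forall>i\<in>charts M. \<forall>u v. smooth_on (chart_img M i) (\<lambda>x. D i x u v)) \<and>
    (\<forall>i\<in>charts M. \<forall>j\<in>charts M. \<forall>x\<in>overlap M i j. \<forall>u v.
       ddir (trans_map M i j) x (D i x u v) =
       ddir (\<lambda>y. ddir (trans_map M i j) y v) x u +
       D j (trans_map M i j x) (ddir (trans_map M i j) x u) (ddir (trans_map M i j) x v))"

definition bracket :: "('e::euclidean_space \<Rightarrow> 'e) \<Rightarrow> ('e \<Rightarrow> 'e) \<Rightarrow> 'e \<Rightarrow> 'e"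
  where "bracket X Y x = ddir Y x (X x) - ddir X x (Y x)"

definition cov ::
    "('i, 'e::euclidean_space) connection \<Rightarrow> 'i \<Rightarrow> ('e \<Rightarrow> 'e) \<Rightarrow> ('e \<Rightarrow> 'e) \<Rightarrow> 'e \<Rightarrow> 'e"
  where "cov D i X Y x = ddir Y x (X x) + D i x (X x) (Y x)"

text \<open>
  Torsion, curvature and the covariant derivatives of tensors are tensorial in all their arguments,
  so their values on tangent vectors are computed from the extensions of these vectors to fields
  that are constant in the coordinates.
\<close>

definition torsion ::
    "('i, 'e::euclidean_space) connection \<Rightarrow> 'i \<Rightarrow> 'e \<Rightarrow> 'e \<Rightarrow> 'e \<Rightarrow> 'e"
  where "torsion D i x u v =
    (let X = (\<lambda>_. u); Y = (\<lambda>_. v)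
     in cov D i X Y x - cov D i Y X x - bracket X Y x)"

definition curvature ::
    "('i, 'e::euclidean_space) connection \<Rightarrow> 'i \<Rightarrow> 'e \<Rightarrow> 'e \<Rightarrow> 'e \<Rightarrow> 'e \<Rightarrow> 'e"
  where "curvature D i x u v w =
    (let X = (\<lambda>_. u); Y = (\<lambda>_. v); Z = (\<lambda>_. w)
     in cov D i X (cov D i Y Z) x - cov D i Y (cov D i X Z) x - cov D i (bracket X Y) Z x)"

definition metric_connection ::
    "('i, 'a, 'e::euclidean_space) atlas \<Rightarrow> ('i, 'e) metric \<Rightarrow> ('i, 'e) connection \<Rightarrow> bool"
  where "metric_connection M g D \<longleftrightarrow>
    (\<forall>i\<in>charts M. \<forall>x\<in>chart_img M i. \<forall>u v w.
       ddir (\<lambda>y. g i y v w) x u =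
       g i x (cov D i (\<lambda>_. u) (\<lambda>_. v) x) w + g i x v (cov D i (\<lambda>_. u) (\<lambda>_. w) x))"

definition parallel_endo ::
    "('i, 'a, 'e::euclidean_space) atlas \<Rightarrow> ('i, 'e) endo_field \<Rightarrow> ('i, 'e) connection \<Rightarrow> bool"
  where "parallel_endo M A D \<longleftrightarrow>
    (\<forall>i\<in>charts M. \<forall>x\<in>chart_img M i. \<forall>u v.
       cov D i (\<lambda>_. u) (\<lambda>y. A i y v) x = A i x (cov D i (\<lambda>_. u) (\<lambda>_. v) x))"

definition levi_civita ::
    "('i, 'a, 'e::euclidean_space) atlas \<Rightarrow> ('i, 'e) metric \<Rightarrow> ('i, 'e) connection \<Rightarrow> bool"
  where "levi_civita M g D \<longleftrightarrow>
    affine_connection M D \<and> metric_connection M g D \<and>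
    (\<forall>i\<in>charts M. \<forall>x\<in>chart_img M i. \<forall>u v. torsion D i x u v = 0)"

subsection \<open>Contact forms\<close>

text \<open>
  An alternating \<open>p\<close>-form at a point is a function of the vectors \<open>v 0, \<dots>, v (p - 1)\<close> only.
\<close>

definition wedge ::
    "nat \<Rightarrow> nat \<Rightarrow> ((nat \<Rightarrow> 'e) \<Rightarrow> real) \<Rightarrow> ((nat \<Rightarrow> 'e) \<Rightarrow> real) \<Rightarrow> (nat \<Rightarrow> 'e) \<Rightarrow> real"
  where "wedge p q \<omega> \<eta> v =
    (\<Sum>\<sigma> | \<sigma> permutes {..<p + q}.
       of_int (sign \<sigma>) * \<omega> (\<lambda>k. v (\<sigma> k)) * \<eta> (\<lambda>k. v (\<sigma> (p + k)))) / (fact p * fact q)"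

fun wedge_power ::
    "nat \<Rightarrow> ((nat \<Rightarrow> 'e) \<Rightarrow> real) \<Rightarrow> nat \<Rightarrow> (nat \<Rightarrow> 'e) \<Rightarrow> real" where
  "wedge_power p \<omega> 0 = (\<lambda>v. 1)"
| "wedge_power p \<omega> (Suc k) = wedge p (p * k) \<omega> (wedge_power p \<omega> k)"

definition ext_deriv1 :: "('i \<Rightarrow> 'e::euclidean_space \<Rightarrow> 'e \<Rightarrow> real) \<Rightarrow> 'i \<Rightarrow> 'e \<Rightarrow> 'e \<Rightarrow> 'e \<Rightarrow> real"
  where "ext_deriv1 \<alpha> i x u v = ddir (\<lambda>y. \<alpha> i y v) x u - ddir (\<lambda>y. \<alpha> i y u) x v"

definition contact_form ::
    "nat \<Rightarrow> ('i, 'a, 'e::euclidean_space) atlas \<Rightarrow> ('i \<Rightarrow> 'e \<Rightarrow> 'e \<Rightarrow> real) \<Rightarrow> bool"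
  where "contact_form m M \<alpha> \<longleftrightarrow>
    (\<forall>i\<in>charts M. \<forall>x\<in>chart_img M i.
       wedge 1 (2 * m) (\<lambda>v. \<alpha> i x (v 0))
         (wedge_power 2 (\<lambda>v. ext_deriv1 \<alpha> i x (v 0) (v 1)) m) \<noteq> (\<lambda>v. 0))"

subsection \<open>Sasakian manifolds\<close>

text \<open>The Lie derivative of \<open>g\<close> along \<open>X\<close> vanishes.\<close>

definition killing_field ::
    "('i, 'a, 'e::euclidean_space) atlas \<Rightarrow> ('i, 'e) metric \<Rightarrow> ('i, 'e) vec_field \<Rightarrow> bool"
  where "killing_field M g X \<longleftrightarrow>
    (\<forall>i\<in>charts M. \<forall>x\<in>chart_img M i. \<forall>u v.
       ddir (\<lambda>y. g i y u v) x (X i x) + g i x (ddir (X i) x u) v + g i x u (ddir (X i) x v) = 0)"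

definition dual_form :: "('i, 'e) metric \<Rightarrow> ('i, 'e) vec_field \<Rightarrow> 'i \<Rightarrow> 'e \<Rightarrow> 'e \<Rightarrow> real"
  where "dual_form g \<xi> i x u = g i x u (\<xi> i x)"

definition horizontal :: "('i, 'e) metric \<Rightarrow> ('i, 'e) vec_field \<Rightarrow> 'i \<Rightarrow> 'e \<Rightarrow> 'e set"
  where "horizontal g \<xi> i x = {u. g i x u (\<xi> i x) = 0}"

definition sasaki_endo ::
    "real \<Rightarrow> ('i, 'e::euclidean_space) connection \<Rightarrow> ('i, 'e) vec_field \<Rightarrow> ('i, 'e) endo_field"
  where "sasaki_endo c D \<xi> i x u = (1 / c) *\<^sub>R cov D i (\<lambda>_. u) (\<xi> i) x"

text \<open>
  Integrability of a complex structure \<open>J\<close> on a distribution \<open>H\<close>: the sections of the bundle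
  $H^{1,0}$ of vectors $X - \sqrt{-1}\,JX$ with $X \in H$ are closed under the bracket.  Here
  $[X - \sqrt{-1}\,JX, Y - \sqrt{-1}\,JY] = A - \sqrt{-1}\,B$ with \<open>A\<close> and \<open>B\<close> as below.
\<close>

definition integrable_on_distribution ::
    "('i, 'a, 'e::euclidean_space) atlas \<Rightarrow> ('i \<Rightarrow> 'e \<Rightarrow> 'e set) \<Rightarrow> ('i, 'e) endo_field \<Rightarrow> bool"
  where "integrable_on_distribution M H J \<longleftrightarrow>
    (\<forall>i\<in>charts M. \<forall>X Y.
       smooth_on (chart_img M i) X \<and> smooth_on (chart_img M i) Y \<and>
       (\<forall>x\<in>chart_img M i. X x \<in> H i x \<and> Y x \<in> H i x) \<longrightarrow>
       (\<forall>x\<in>chart_img M i.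
          let JX = (\<lambda>y. J i y (X y)); JY = (\<lambda>y. J i y (Y y));
              A = bracket X Y x - bracket JX JY x;
              B = bracket JX Y x + bracket X JY x
          in A \<in> H i x \<and> B = J i x A))"

text \<open>
  \<open>sasakian m c N g D \<xi>\<close>: the triple \<open>(N, g, \<xi>)\<close> is a Sasakian manifold of dimension \<open>2m + 1\<close> with
  constant \<open>c\<close>, and \<open>D\<close> is the Levi-Civita connection of \<open>g\<close>.
\<close>

definition sasakian ::
    "nat \<Rightarrow> real \<Rightarrow> ('i, 'a::{t2_space,second_countable_topology}, 'e::euclidean_space) atlas \<Rightarrow>
     ('i, 'e) metric \<Rightarrow> ('i, 'e) connection \<Rightarrow> ('i, 'e) vec_field \<Rightarrow> bool"
  where "sasakian m c N g D \<xi> \<longleftrightarrow>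
    smooth_manifold N \<and> DIM('e) = 2 * m + 1 \<and>
    riemannian_metric N g \<and> levi_civita N g D \<and>
    vector_field N \<xi> \<and>
    (\<forall>i\<in>charts N. \<forall>x\<in>chart_img N i. g i x (\<xi> i x) (\<xi> i x) = 1) \<and>
    killing_field N g \<xi> \<and>
    c > 0 \<and>
    (let H = horizontal g \<xi>; J = sasaki_endo c D \<xi> in
      (\<forall>i\<in>charts N. \<forall>x\<in>chart_img N i. \<forall>u\<in>H i x.
         J i x u \<in> H i x \<and> J i x (J i x u) = - u \<and>
         (\<forall>v\<in>H i x. g i x (J i x u) (J i x v) = g i x u v)) \<and>
      integrable_on_distribution N H J) \<and>
    contact_form m N (dual_form g \<xi>)"

subsection \<open>The standard Hermitian structure on a product\<close>

definition product_atlas ::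
    "('i, 'a, 'e) atlas \<Rightarrow> ('j, 'b, 'f) atlas \<Rightarrow> ('i \<times> 'j, 'a \<times> 'b, 'e \<times> 'f) atlas"
  where "product_atlas M N =
    \<lparr> charts = charts M \<times> charts N,
      chart_dom = (\<lambda>(i, j). chart_dom M i \<times> chart_dom N j),
      chart_map = (\<lambda>(i, j). map_prod (chart_map M i) (chart_map N j)) \<rparr>"

definition product_metric ::
    "('i, 'e) metric \<Rightarrow> ('j, 'f) metric \<Rightarrow> ('i \<times> 'j, 'e \<times> 'f) metric"
  where "product_metric g1 g2 =
    (\<lambda>(i, j) (x, y) (u1, u2) (v1, v2). g1 i x u1 v1 + g2 j y u2 v2)"

text \<open>
  Writing \<open>u\<^sub>k = a\<^sub>k \<xi>\<^sub>k + h\<^sub>k\<close> with \<open>h\<^sub>k\<close> in \<open>H\<^sub>k\<close>, the linear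
  extension of \<open>\<xi>\<^sub>1 \<mapsto> \<xi>\<^sub>2\<close>, \<open>\<xi>\<^sub>2 \<mapsto> - \<xi>\<^sub>1\<close>,
  \<open>h\<^sub>k \<mapsto> J\<^sub>k h\<^sub>k\<close>.
\<close>

definition standard_J ::
    "real \<Rightarrow> real \<Rightarrow> ('i, 'e::euclidean_space) metric \<Rightarrow> ('j, 'f::euclidean_space) metric \<Rightarrow>
     ('i, 'e) connection \<Rightarrow> ('j, 'f) connection \<Rightarrow> ('i, 'e) vec_field \<Rightarrow> ('j, 'f) vec_field \<Rightarrow>
     ('i \<times> 'j, 'e \<times> 'f) endo_field"
  where "standard_J c1 c2 g1 g2 D1 D2 \<xi>1 \<xi>2 =
    (\<lambda>(i, j) (x, y) (u1, u2).
       let a1 = g1 i x u1 (\<xi>1 i x); h1 = u1 - a1 *\<^sub>R \<xi>1 i x;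
           a2 = g2 j y u2 (\<xi>2 j y); h2 = u2 - a2 *\<^sub>R \<xi>2 j y
       in (sasaki_endo c1 D1 \<xi>1 i x h1 - a2 *\<^sub>R \<xi>1 i x,
           sasaki_endo c2 D2 \<xi>2 j y h2 + a1 *\<^sub>R \<xi>2 j y))"

subsection \<open>Hermitian manifolds and the Strominger connection\<close>

text \<open>The Nijenhuis tensor of \<open>J\<close>, evaluated on coordinate-constant fields.\<close>

definition nijenhuis ::
    "('i, 'e::euclidean_space) endo_field \<Rightarrow> 'i \<Rightarrow> 'e \<Rightarrow> 'e \<Rightarrow> 'e \<Rightarrow> 'e"
  where "nijenhuis J i x u v =
    (let X = (\<lambda>_. u); Y = (\<lambda>_. v); JX = (\<lambda>y. J i y u); JY = (\<lambda>y. J i y v)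
     in bracket JX JY x - bracket X Y x - J i x (bracket JX Y x + bracket X JY x))"

definition hermitian_manifold ::
    "('i, 'a::{t2_space,second_countable_topology}, 'e::euclidean_space) atlas \<Rightarrow>
     ('i, 'e) metric \<Rightarrow> ('i, 'e) endo_field \<Rightarrow> bool"
  where "hermitian_manifold M g J \<longleftrightarrow>
    smooth_manifold M \<and> riemannian_metric M g \<and> endomorphism_field M J \<and>
    (\<forall>i\<in>charts M. \<forall>x\<in>chart_img M i. \<forall>u v.
       J i x (J i x u) = - u \<and> g i x (J i x u) (J i x v) = g i x u v \<and>
       nijenhuis J i x u v = 0)"

definition strominger_connection ::
    "('i, 'a, 'e::euclidean_space) atlas \<Rightarrow> ('i, 'e) metric \<Rightarrow> ('i, 'e) endo_field \<Rightarrow>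
     ('i, 'e) connection \<Rightarrow> bool"
  where "strominger_connection M g J D \<longleftrightarrow>
    affine_connection M D \<and> metric_connection M g D \<and> parallel_endo M J D \<and>
    (\<forall>i\<in>charts M. \<forall>x\<in>chart_img M i. \<forall>u v w.
       g i x (torsion D i x u v) w = - g i x (torsion D i x v u) w \<and>
       g i x (torsion D i x u v) w = - g i x (torsion D i x u w) v)"

text \<open>
  The Strominger connection exists and its values on the chart images are unique, so the
  existential quantifier below just names it.
\<close>

definition strominger_kahler_like ::
    "('i, 'a::{t2_space,second_countable_topology}, 'e::euclidean_space) atlas \<Rightarrow>
     ('i, 'e) metric \<Rightarrow> ('i, 'e) endo_field \<Rightarrow> bool"
  where "strominger_kahler_like M g J \<longleftrightarrow>
    hermitian_manifold M g J \<and>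
    (\<exists>D. strominger_connection M g J D \<and>
      (\<forall>i\<in>charts M. \<forall>p\<in>chart_img M i. \<forall>x y z w.
         let R = (\<lambda>x y z w. g i p (curvature D i p x y z) w); Jp = J i p in
           R x y z w + R y z x w + R z x y w = 0 \<and>
           R x y z w = R (Jp x) (Jp y) z w \<and>
           R x y z w = R x y (Jp z) (Jp w)))"

end

theory Submission
  imports Defs
begin

text \<open>
  On a Sasakian manifold with constant \<open>c\<close>, Reeb field $\xi$ and $\varphi = \frac1c \nabla \xi$, integrability
  and $d\eta = 2c\, g(\varphi\cdot,\cdot)$ give $(\nabla_X \varphi) Y = c(\eta(Y) X - g(X,Y)\xi)$. Hence the
  characteristic connection
  $\nabla_X Y + c(\eta(X)\varphi Y - \eta(Y)\varphi X + g(\varphi X,Y)\xi)$ preserves $g$, $\xi$ and $\varphi$, and its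
  torsion $T = \eta\wedge d\eta$ is parallel. The product of the two characteristic connections is the
  Strominger connection of the product. As the torsion is parallel, the first Bianchi identity turns
  the cyclic sum of the curvature into the cyclic sum of $T(T(X,Y),Z)$, which represents
  $d\eta\wedge d\eta$ on each factor; it vanishes if and only if the contact distributions have
  dimension at most 2. The other Kaehler symmetries follow from this one.
\<close>

subsection \<open>Calculus of smooth maps\<close>

text \<open>The formula for \<nabla>\<phi> is the odd-dimensional form of the theorem that an
  integrable almost Hermitian structure with closed fundamental form is Kaehler: horizontal
  arguments are settled by trilinear algebra, arguments along \<xi> by differentiating \<phi>\<xi> =
  0 and by skewness and closedness. The tensor added to the Levi-Civita connection is chosen to
  cancel both \<nabla>\<xi> and \<nabla>\<phi>. Although J mixes the two Reeb fields, the torsion of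
  the product has no mixed components, so the factors decouple. With F = g(\<phi>., .), the
  obstruction on each factor is the 4-form F wedge F: it vanishes for degree reasons on a plane and
  is nonzero on e, \<phi> e, f, \<phi> f once two orthogonal \<phi>-invariant horizontal planes
  exist. The Kaehler-like condition only provides some Strominger connection; uniqueness identifies
  it with the explicit one. Fields are total functions that matter only on chart images, so
  identities are differentiated by comparing functions on open sets.\<close>

lemma ddir_eqI: "(f has_derivative f') (at x) \<Longrightarrow> ddir f x = f'"
  by (metis frechet_derivative_at)

lemma has_derivative_ddir: "f differentiable (at x) \<Longrightarrow> (f has_derivative ddir f x) (at x)"
  by (simp add: frechet_derivative_works)

lemma linear_ddir: "f differentiable (at x) \<Longrightarrow> linear (ddir f x)"
  by (rule linear_frechet_derivative)

lemma differentiable_cong_open: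
  assumes "open S" "x \<in> S" "\<And>y. y \<in> S \<Longrightarrow> f y = g y"
  shows "f differentiable (at x) \<longleftrightarrow> g differentiable (at x)"
  unfolding differentiable_def
  using has_derivative_transform_within_open[OF _ assms(1,2), of f _ UNIV g]
    has_derivative_transform_within_open[OF _ assms(1,2), of g _ UNIV f] assms(3) by auto

text \<open>A derivative is a choice from the set of possible derivatives. Functions that agree near
  x have the same set, so the choices agree even where this set is empty.\<close>

lemma ddir_cong_open:
  assumes "open S" "x \<in> S" "\<And>y. y \<in> S \<Longrightarrow> f y = g y"
  shows "ddir f x = ddir g x"
proof -
  have "(f has_derivative f') (at x) \<longleftrightarrow> (g has_derivative f') (at x)" for f'
    using has_derivative_transform_within_open[OF _ assms(1,2), of f _ UNIV g]
      has_derivative_transform_within_open[OF _ assms(1,2), of g _ UNIV f] assms(3) by auto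
  then show ?thesis by (simp add: frechet_derivative_def)
qed

lemma Ck_on_cong:
  assumes "open S" "\<And>y. y \<in> S \<Longrightarrow> f y = g y"
  shows "Ck_on k S f \<longleftrightarrow> Ck_on k S g"
  using assms(2)
proof (induction k arbitrary: f g)
  case 0
  then show ?case by (simp cong: continuous_on_cong)
next
  case (Suc k)
  have "Ck_on k S (\<lambda>x. ddir f x u) = Ck_on k S (\<lambda>x. ddir g x u)" for u
    by (rule Suc.IH) (metis ddir_cong_open[OF assms(1)] Suc.prems)
  moreover have "f differentiable (at x) \<longleftrightarrow> g differentiable (at x)" if "x \<in> S" for x
    by (rule differentiable_cong_open[OF assms(1) that Suc.prems])
  ultimately show ?case by simp
qed

lemma smooth_on_cong:
  assumes "open S" "\<And>y. y \<in> S \<Longrightarrow> f y = g y"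
  shows "smooth_on S f \<longleftrightarrow> smooth_on S g"
  unfolding smooth_on_def using Ck_on_cong[of S f g] assms by blast

text \<open>The product rule leaves undifferentiated factors behind; inductions on the order need
  these at the lower order.\<close>

lemma Ck_on_Suc_imp: "Ck_on (Suc k) S f \<Longrightarrow> Ck_on k S f"
proof (induction k arbitrary: f)
  case 0
  then show ?case
    by (auto intro!: continuous_at_imp_continuous_on differentiable_imp_continuous_within)
next
  case (Suc k)
  then show ?case by (metis Ck_on.simps(2))
qed

lemma smooth_on_differentiable: "smooth_on S f \<Longrightarrow> x \<in> S \<Longrightarrow> f differentiable (at x)"
  unfolding smooth_on_def by (meson Ck_on.simps(2))

lemma smooth_on_ddir: "smooth_on S f \<Longrightarrow> smooth_on S (\<lambda>x. ddir f x u)"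
  unfolding smooth_on_def using Ck_on.simps(2) by blast

lemma Ck_on_const: "Ck_on k S (\<lambda>x. a)"
  by (induction k arbitrary: a) auto

lemma smooth_on_const [simp]: "smooth_on S (\<lambda>x. a)"
  by (simp add: smooth_on_def Ck_on_const)

section \<open>Rules of differentiation\<close>

lemma ddir_add:
  assumes "f differentiable (at x)" "g differentiable (at x)"
  shows "ddir (\<lambda>y. f y + g y) x u = ddir f x u + ddir g x u"
  by (subst ddir_eqI[OF has_derivative_add[OF has_derivative_ddir has_derivative_ddir]])
    (use assms in auto)

lemma ddir_diff:
  assumes "f differentiable (at x)" "g differentiable (at x)"
  shows "ddir (\<lambda>y. f y - g y) x u = ddir f x u - ddir g x u"
  by (subst ddir_eqI[OF has_derivative_diff[OF has_derivative_ddir has_derivative_ddir]])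
    (use assms in auto)

lemma ddir_bounded_linear:
  assumes "bounded_linear L" "f differentiable (at x)"
  shows "ddir (\<lambda>y. L (f y)) x u = L (ddir f x u)"
  by (subst ddir_eqI[OF bounded_linear.has_derivative[OF assms(1) has_derivative_ddir[OF assms(2)]]])
    simp

lemma ddir_bounded_bilinear:
  assumes "bounded_bilinear B" "f differentiable (at x)" "g differentiable (at x)"
  shows "ddir (\<lambda>y. B (f y) (g y)) x u = B (f x) (ddir g x u) + B (ddir f x u) (g x)"
  by (subst ddir_eqI[OF bounded_bilinear.FDERIV[OF assms(1) has_derivative_ddir[OF assms(2)]
      has_derivative_ddir[OF assms(3)]]]) simp

lemma differentiable_bounded_linear:
  fixes f :: "'e::euclidean_space \<Rightarrow> _"
  shows "bounded_linear L \<Longrightarrow> f differentiable (at x) \<Longrightarrow> (\<lambda>y. L (f y)) differentiable (at x)"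
  by (rule differentiableI[OF bounded_linear.has_derivative[OF _ has_derivative_ddir]])

lemma differentiable_bounded_bilinear:
  assumes "bounded_bilinear B" "f differentiable (at x)" "g differentiable (at x)"
  shows "(\<lambda>y. B (f y) (g y)) differentiable (at x)"
  using bounded_bilinear.FDERIV[OF assms(1)] assms(2,3) by (fastforce simp: differentiable_def)

section \<open>Closure properties of smooth maps\<close>

lemma Ck_on_add:
  assumes "open S"
  shows "Ck_on k S f \<Longrightarrow> Ck_on k S g \<Longrightarrow> Ck_on k S (\<lambda>x. f x + g x)"
proof (induction k arbitrary: f g)
  case 0
  then show ?case by (auto intro: continuous_on_add)
next
  case (Suc k)
  have "Ck_on k S (\<lambda>x. ddir (\<lambda>y. f y + g y) x u) =
      Ck_on k S (\<lambda>x. ddir f x u + ddir g x u)" for u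
    by (rule Ck_on_cong[OF assms]) (use Suc.prems in \<open>auto simp: ddir_add\<close>)
  then show ?case using Suc by auto
qed

lemma Ck_on_bounded_linear:
  assumes "open S" "bounded_linear L"
  shows "Ck_on k S f \<Longrightarrow> Ck_on k S (\<lambda>x. L (f x))"
proof (induction k arbitrary: f)
  case 0
  then show ?case by (auto intro: bounded_linear.continuous_on[OF assms(2)])
next
  case (Suc k)
  have "Ck_on k S (\<lambda>x. ddir (\<lambda>y. L (f y)) x u) = Ck_on k S (\<lambda>x. L (ddir f x u))" for u
    by (rule Ck_on_cong[OF assms(1)]) (use Suc.prems assms in \<open>auto simp: ddir_bounded_linear\<close>)
  then show ?case using Suc by (auto intro: differentiable_bounded_linear[OF assms(2)])
qed

lemma Ck_on_bounded_bilinear: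
  assumes "open S" "bounded_bilinear B"
  shows "Ck_on k S f \<Longrightarrow> Ck_on k S g \<Longrightarrow> Ck_on k S (\<lambda>x. B (f x) (g x))"
proof (induction k arbitrary: f g)
  case 0
  then show ?case by (auto intro: bounded_bilinear.continuous_on[OF assms(2)])
next
  case (Suc k)
  have "Ck_on k S (\<lambda>x. ddir (\<lambda>y. B (f y) (g y)) x u) =
      Ck_on k S (\<lambda>x. B (f x) (ddir g x u) + B (ddir f x u) (g x))" for u
    by (rule Ck_on_cong[OF assms(1)])
      (use Suc.prems assms in \<open>auto simp: ddir_bounded_bilinear\<close>)
  moreover have "Ck_on k S (\<lambda>x. B (f x) (ddir g x u) + B (ddir f x u) (g x))" for u
    by (rule Ck_on_add[OF assms(1)]; rule Suc.IH)
      (use Suc.prems Ck_on_Suc_imp in auto)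
  ultimately show ?case using Suc.prems
    by (auto intro: differentiable_bounded_bilinear[OF assms(2)])
qed

lemma smooth_on_add:
  "open S \<Longrightarrow> smooth_on S f \<Longrightarrow> smooth_on S g \<Longrightarrow> smooth_on S (\<lambda>x. f x + g x)"
  by (simp add: smooth_on_def Ck_on_add)

lemma smooth_on_bounded_linear:
  "open S \<Longrightarrow> bounded_linear L \<Longrightarrow> smooth_on S f \<Longrightarrow> smooth_on S (\<lambda>x. L (f x))"
  by (simp add: smooth_on_def Ck_on_bounded_linear)

lemma smooth_on_bounded_bilinear:
  "open S \<Longrightarrow> bounded_bilinear B \<Longrightarrow> smooth_on S f \<Longrightarrow> smooth_on S g
    \<Longrightarrow> smooth_on S (\<lambda>x. B (f x) (g x))"
  by (simp add: smooth_on_def Ck_on_bounded_bilinear)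

lemma smooth_on_scaleR:
  "open S \<Longrightarrow> smooth_on S f \<Longrightarrow> smooth_on S g \<Longrightarrow> smooth_on S (\<lambda>x. f x *\<^sub>R g x)"
  by (rule smooth_on_bounded_bilinear[OF _ bounded_bilinear_scaleR])

lemma smooth_on_uminus: "open S \<Longrightarrow> smooth_on S f \<Longrightarrow> smooth_on S (\<lambda>x. - f x)"
  by (rule smooth_on_bounded_linear[where L = uminus])
    (auto intro: bounded_linear_minus bounded_linear_ident)

lemma smooth_on_diff:
  "open S \<Longrightarrow> smooth_on S f \<Longrightarrow> smooth_on S g \<Longrightarrow> smooth_on S (\<lambda>x. f x - g x)"
  using smooth_on_add[of S f "\<lambda>x. - g x"] smooth_on_uminus[of S g] by simp

lemma smooth_on_sum:
  assumes "open S" "\<And>i. i \<in> I \<Longrightarrow> smooth_on S (f i)"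
  shows "smooth_on S (\<lambda>x. \<Sum>i\<in>I. f i x)"
proof (cases "finite I")
  case True
  then show ?thesis using assms(2)
    by (induction I) (auto intro!: smooth_on_add[OF assms(1)])
qed simp

section \<open>Linear and bilinear maps depending on a point\<close>

lemma linear_expand_Basis:
  assumes "linear A"
  shows "A v = (\<Sum>b\<in>Basis. (v \<bullet> b) *\<^sub>R A b)"
proof -
  have "A v = A (\<Sum>b\<in>Basis. (v \<bullet> b) *\<^sub>R b)" by (simp add: euclidean_representation)
  also have "\<dots> = (\<Sum>b\<in>Basis. (v \<bullet> b) *\<^sub>R A b)"
    by (simp add: linear_sum[OF assms] linear_scale[OF assms])
  finally show ?thesis .
qed

text \<open>Tensor fields are curried functions, differentiable for each fixed argument. Expanding
  that argument in a basis turns \<open>A y (f y)\<close> into a finite sum of products, to which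
  the usual product rule applies.\<close>

lemma has_derivative_linear_family:
  fixes A :: "'e::euclidean_space \<Rightarrow> 'v::euclidean_space \<Rightarrow> 'w::real_normed_vector"
  assumes S: "open S" "x \<in> S" and lin: "\<And>y. y \<in> S \<Longrightarrow> linear (A y)"
    and A: "\<And>v. (\<lambda>y. A y v) differentiable (at x)" and f: "f differentiable (at x)"
  shows "((\<lambda>y. A y (f y)) has_derivative (\<lambda>u. ddir (\<lambda>y. A y (f x)) x u + A x (ddir f x u))) (at x)"
proof -
  let ?D = "\<lambda>u. \<Sum>b\<in>Basis. (f x \<bullet> b) *\<^sub>R ddir (\<lambda>y. A y b) x u + (ddir f x u \<bullet> b) *\<^sub>R A x b"
  have D: "((\<lambda>y. \<Sum>b\<in>Basis. (f y \<bullet> b) *\<^sub>R A y b) has_derivative ?D) (at x)"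
    by (intro has_derivative_sum has_derivative_scaleR has_derivative_inner_left
        has_derivative_ddir f A)
  have dA: "ddir (\<lambda>y. A y v) x u = (\<Sum>b\<in>Basis. (v \<bullet> b) *\<^sub>R ddir (\<lambda>y. A y b) x u)" for u v
  proof -
    have "((\<lambda>y. \<Sum>b\<in>Basis. (v \<bullet> b) *\<^sub>R A y b) has_derivative
        (\<lambda>u. \<Sum>b\<in>Basis. (v \<bullet> b) *\<^sub>R ddir (\<lambda>y. A y b) x u)) (at x)"
      by (intro has_derivative_sum has_derivative_scaleR_right has_derivative_ddir A)
    moreover have "ddir (\<lambda>y. A y v) x = ddir (\<lambda>y. \<Sum>b\<in>Basis. (v \<bullet> b) *\<^sub>R A y b) x"
      by (rule ddir_cong_open[OF S]) (rule linear_expand_Basis[OF lin])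
    ultimately show ?thesis by (simp add: ddir_eqI)
  qed
  have Ax: "A x v = (\<Sum>b\<in>Basis. (v \<bullet> b) *\<^sub>R A x b)" for v
    by (rule linear_expand_Basis[OF lin[OF S(2)]])
  have "?D = (\<lambda>u. ddir (\<lambda>y. A y (f x)) x u + A x (ddir f x u))"
    unfolding dA[of "f x"] Ax[of "ddir f x _"] sum.distrib ..
  with D have "((\<lambda>y. \<Sum>b\<in>Basis. (f y \<bullet> b) *\<^sub>R A y b) has_derivative
      (\<lambda>u. ddir (\<lambda>y. A y (f x)) x u + A x (ddir f x u))) (at x)"
    by (simp only:)
  then show ?thesis
    by (rule has_derivative_transform_within_open[OF _ S]) (rule linear_expand_Basis[OF lin, symmetric])
qed

lemmas ddir_linear_family = has_derivative_linear_family[THEN ddir_eqI, THEN fun_cong]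

lemma smooth_on_linear_family:
  fixes A :: "'e::euclidean_space \<Rightarrow> 'v::euclidean_space \<Rightarrow> 'w::real_normed_vector"
  assumes S: "open S" and lin: "\<And>y. y \<in> S \<Longrightarrow> linear (A y)"
    and A: "\<And>v. smooth_on S (\<lambda>y. A y v)" and f: "smooth_on S f"
  shows "smooth_on S (\<lambda>y. A y (f y))"
proof -
  have "smooth_on S (\<lambda>y. \<Sum>b\<in>Basis. (f y \<bullet> b) *\<^sub>R A y b)"
    by (intro smooth_on_sum smooth_on_scaleR S A smooth_on_bounded_linear[OF S _ f]
        bounded_linear_inner_left)
  then show ?thesis
    by (subst smooth_on_cong[OF S]) (use linear_expand_Basis[OF lin] in auto)
qed

text \<open>A bilinear family is a linear family in either slot, so the linear case is used twice,
  the second time with the first argument frozen at its value at x.\<close>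

lemma
  fixes B :: "'e::euclidean_space \<Rightarrow> 'v::euclidean_space \<Rightarrow> 'v'::euclidean_space \<Rightarrow> 'w::real_normed_vector"
  assumes S: "open S" and bil: "\<And>y. y \<in> S \<Longrightarrow> bilinear (B y)"
    and sB: "\<And>v w. smooth_on S (\<lambda>y. B y v w)" and sX: "smooth_on S X" and sY: "smooth_on S Y"
  shows smooth_on_bilinear_family: "smooth_on S (\<lambda>y. B y (X y) (Y y))"
    and ddir_bilinear_family: "x \<in> S \<Longrightarrow> ddir (\<lambda>y. B y (X y) (Y y)) x u =
      ddir (\<lambda>y. B y (X x) (Y x)) x u + B x (ddir X x u) (Y x) + B x (X x) (ddir Y x u)"
proof -
  have 1: "linear (\<lambda>v. B y v w)" "linear (B y v)" if "y \<in> S" for y v w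
    using bil[OF that] by (auto simp: bilinear_def)
  have 2: "smooth_on S (\<lambda>y. B y v (Y y))" for v
    by (rule smooth_on_linear_family[OF S 1(2) sB sY])
  show "smooth_on S (\<lambda>y. B y (X y) (Y y))"
    by (rule smooth_on_linear_family[OF S _ 2 sX]) (rule 1)
  assume x: "x \<in> S"
  have "ddir (\<lambda>y. B y (X y) (Y y)) x u =
      ddir (\<lambda>y. B y (X x) (Y y)) x u + B x (ddir X x u) (Y x)"
    using ddir_linear_family[OF S x, of "\<lambda>y v. B y v (Y y)" X u] 1(1)
      smooth_on_differentiable[OF 2 x] smooth_on_differentiable[OF sX x] by auto
  also have "ddir (\<lambda>y. B y (X x) (Y y)) x u = ddir (\<lambda>y. B y (X x) (Y x)) x u + B x (X x) (ddir Y x u)"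
    using ddir_linear_family[OF S x, of "\<lambda>y v. B y (X x) v" Y u] 1(2)
      smooth_on_differentiable[OF sB x] smooth_on_differentiable[OF sY x] by auto
  finally show "ddir (\<lambda>y. B y (X y) (Y y)) x u =
      ddir (\<lambda>y. B y (X x) (Y x)) x u + B x (ddir X x u) (Y x) + B x (X x) (ddir Y x u)"
    by simp
qed

subsection \<open>Symmetry of second derivatives\<close>

text \<open>Two uses of the mean value theorem on the second difference over a parallelogram: along
  u for the increment of f in direction v, then along v for the derivative of f in direction
  u.\<close>

lemma mixed_difference:
  fixes f :: "'e::euclidean_space \<Rightarrow> real"
  assumes f: "smooth_on S f" and t: "0 < t"
    and S: "\<And>r s. 0 \<le> r \<Longrightarrow> r \<le> t \<Longrightarrow> 0 \<le> s \<Longrightarrow> s \<le> t \<Longrightarrow> x + r *\<^sub>R u + s *\<^sub>R v \<in> S"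
  obtains r s where "0 < r" "r < t" "0 < s" "s < t"
    "f (x + t *\<^sub>R u + t *\<^sub>R v) - f (x + t *\<^sub>R u) - f (x + t *\<^sub>R v) + f x =
      t * t * ddir (\<lambda>z. ddir f z u) (x + r *\<^sub>R u + s *\<^sub>R v) v"
proof -
  have line: "((\<lambda>r. h (y + r *\<^sub>R w)) has_derivative (\<lambda>d. d * ddir h (y + r *\<^sub>R w) w)) (at r)"
    if "h differentiable (at (y + r *\<^sub>R w))" for h :: "'e \<Rightarrow> real" and y w r
  proof -
    have "((\<lambda>r. y + r *\<^sub>R w) has_derivative (\<lambda>d. d *\<^sub>R w)) (at r)"
      by (auto intro!: derivative_eq_intros)
    from has_derivative_compose[OF this has_derivative_ddir[OF that]] linear_ddir[OF that]
    show ?thesis by (simp add: linear_scale)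
  qed
  define \<phi> where "\<phi> r = f ((x + t *\<^sub>R v) + r *\<^sub>R u) - f (x + r *\<^sub>R u)" for r
  have inS: "x + t *\<^sub>R v + r *\<^sub>R u \<in> S" "x + r *\<^sub>R u \<in> S" if "0 \<le> r" "r \<le> t" for r
    using S[of r t] S[of r 0] that t by (auto simp: algebra_simps)
  have "(\<phi> has_derivative (\<lambda>d. d * (ddir f ((x + t *\<^sub>R v) + r *\<^sub>R u) u - ddir f (x + r *\<^sub>R u) u))) (at r)"
    if "0 \<le> r" "r \<le> t" for r
    unfolding \<phi>_def right_diff_distrib
    by (intro has_derivative_diff line smooth_on_differentiable[OF f] inS that)
  then have "\<exists>r\<in>{0<..<t}. \<phi> t - \<phi> 0 =
      (\<lambda>d. d * (ddir f ((x + t *\<^sub>R v) + r *\<^sub>R u) u - ddir f (x + r *\<^sub>R u) u)) (t - 0)"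
    by (intro mvt_simple t) (auto intro: has_derivative_at_withinI)
  then obtain r where r: "0 < r" "r < t" and \<phi>: "\<phi> t - \<phi> 0 =
      t * (ddir f ((x + t *\<^sub>R v) + r *\<^sub>R u) u - ddir f (x + r *\<^sub>R u) u)" by auto
  let ?g = "\<lambda>z. ddir f z u"
  have inS': "x + r *\<^sub>R u + s *\<^sub>R v \<in> S" if "0 \<le> s" "s \<le> t" for s
    using S[of r s] r that by auto
  have "((\<lambda>s. ?g (x + r *\<^sub>R u + s *\<^sub>R v)) has_derivative
      (\<lambda>d. d * ddir ?g (x + r *\<^sub>R u + s *\<^sub>R v) v)) (at s)" if "0 \<le> s" "s \<le> t" for s
    by (intro line smooth_on_differentiable[OF smooth_on_ddir[OF f]] inS' that)
  then have "\<exists>s\<in>{0<..<t}. ?g (x + r *\<^sub>R u + t *\<^sub>R v) - ?g (x + r *\<^sub>R u + 0 *\<^sub>R v) =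
      (\<lambda>d. d * ddir ?g (x + r *\<^sub>R u + s *\<^sub>R v) v) (t - 0)"
    by (intro mvt_simple[OF t, where f = "\<lambda>s. ?g (x + r *\<^sub>R u + s *\<^sub>R v)"])
      (auto intro: has_derivative_at_withinI)
  then obtain s where s: "0 < s" "s < t" "?g (x + r *\<^sub>R u + t *\<^sub>R v) - ?g (x + r *\<^sub>R u) =
      t * ddir ?g (x + r *\<^sub>R u + s *\<^sub>R v) v" by auto
  have "f (x + t *\<^sub>R u + t *\<^sub>R v) - f (x + t *\<^sub>R u) - f (x + t *\<^sub>R v) + f x = \<phi> t - \<phi> 0"
    by (simp add: \<phi>_def algebra_simps)
  also have "\<dots> = t * (t * ddir ?g (x + r *\<^sub>R u + s *\<^sub>R v) v)"
    unfolding \<phi> s(3)[symmetric] by (simp add: algebra_simps)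
  finally show ?thesis using that[OF r s(1,2)] by simp
qed

lemma ddir_ddir_commute_real:
  fixes f :: "'e::euclidean_space \<Rightarrow> real"
  assumes S: "open S" "x \<in> S" and f: "smooth_on S f"
  shows "ddir (\<lambda>y. ddir f y u) x v = ddir (\<lambda>y. ddir f y v) x u"
proof -
  define P where "P u v y = ddir (\<lambda>z. ddir f z u) y v" for u v y
  have cont: "continuous (at x) (P u v)" for u v
    unfolding P_def
    by (intro differentiable_imp_continuous_within smooth_on_differentiable[OF _ S(2)]
        smooth_on_ddir f)
  have "\<bar>P u v x - P v u x\<bar> < e" if "e > 0" for e
  proof -
    from that have e2: "e / 2 > 0" by simp
    from S obtain d0 where d0: "d0 > 0" "ball x d0 \<subseteq> S" by (meson open_contains_ball)
    obtain d1 where d1: "d1 > 0" "\<And>y. dist y x < d1 \<Longrightarrow> \<bar>P u v y - P u v x\<bar> < e / 2"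
      using cont[of u v, unfolded continuous_at_eps_delta dist_real_def, rule_format, OF e2]
      by blast
    obtain d2 where d2: "d2 > 0" "\<And>y. dist y x < d2 \<Longrightarrow> \<bar>P v u y - P v u x\<bar> < e / 2"
      using cont[of v u, unfolded continuous_at_eps_delta dist_real_def, rule_format, OF e2]
      by blast
    define d where "d = min d0 (min d1 d2)"
    \<comment> \<open>The summand 1 keeps n positive when u and v vanish; the 2 in the choice of t
      makes t * n < d strict.\<close>
    define n where "n = norm u + norm v + 1"
    define t where "t = d / (2 * n)"
    have n: "n > 0" unfolding n_def by (meson add_nonneg_pos add_nonneg_nonneg norm_ge_zero zero_less_one)
    have d: "d > 0" using d0 d1 d2 by (simp add: d_def)
    have t: "t > 0" using n d by (simp add: t_def)
    have near: "dist (x + r *\<^sub>R u + s *\<^sub>R v) x < d" if "0 \<le> r" "r \<le> t" "0 \<le> s" "s \<le> t" for r s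
    proof -
      have "dist (x + r *\<^sub>R u + s *\<^sub>R v) x \<le> r * norm u + s * norm v"
        using norm_triangle_ineq[of "r *\<^sub>R u" "s *\<^sub>R v"] that by (simp add: dist_norm)
      also have "\<dots> \<le> t * norm u + t * norm v"
        using that by (intro add_mono mult_right_mono) auto
      also have "\<dots> \<le> t * n" using t by (simp add: n_def algebra_simps)
      also have "\<dots> < d" using n d by (simp add: t_def)
      finally show ?thesis .
    qed
    have inS: "x + r *\<^sub>R u + s *\<^sub>R v \<in> S" if "0 \<le> r" "r \<le> t" "0 \<le> s" "s \<le> t" for r s
      using near[OF that] d0 by (auto simp: d_def dist_commute)
    have inS': "x + r *\<^sub>R v + s *\<^sub>R u \<in> S" if "0 \<le> r" "r \<le> t" "0 \<le> s" "s \<le> t" for r s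
      using inS[OF that(3,4,1,2)] by (simp add: algebra_simps)
    obtain r s where 1: "0 < r" "r < t" "0 < s" "s < t"
      "f (x + t *\<^sub>R u + t *\<^sub>R v) - f (x + t *\<^sub>R u) - f (x + t *\<^sub>R v) + f x =
        t * t * P u v (x + r *\<^sub>R u + s *\<^sub>R v)"
      using mixed_difference[OF f t inS] unfolding P_def by blast
    obtain r' s' where 2: "0 < r'" "r' < t" "0 < s'" "s' < t"
      "f (x + t *\<^sub>R v + t *\<^sub>R u) - f (x + t *\<^sub>R v) - f (x + t *\<^sub>R u) + f x =
        t * t * P v u (x + r' *\<^sub>R v + s' *\<^sub>R u)"
      using mixed_difference[OF f t inS'] unfolding P_def by blast
    \<comment> \<open>Both mixed derivatives compute the same second difference, at points of the
      same small parallelogram.\<close>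
    have "t * t * P u v (x + r *\<^sub>R u + s *\<^sub>R v) = t * t * P v u (x + r' *\<^sub>R v + s' *\<^sub>R u)"
      using 1(5) 2(5) by (simp add: algebra_simps)
    then have "P u v (x + r *\<^sub>R u + s *\<^sub>R v) = P v u (x + r' *\<^sub>R v + s' *\<^sub>R u)"
      using t by simp
    moreover have "\<bar>P u v (x + r *\<^sub>R u + s *\<^sub>R v) - P u v x\<bar> < e / 2"
      using d1(2)[of "x + r *\<^sub>R u + s *\<^sub>R v"] near[of r s] 1 by (simp add: d_def)
    moreover have "\<bar>P v u (x + r' *\<^sub>R v + s' *\<^sub>R u) - P v u x\<bar> < e / 2"
      using d2(2)[of "x + r' *\<^sub>R v + s' *\<^sub>R u"] near[of s' r'] 2
      by (simp add: d_def add.commute add.left_commute)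
    ultimately show ?thesis by linarith
  qed
  from this[of "\<bar>P u v x - P v u x\<bar>"] show ?thesis by (auto simp: P_def)
qed

lemma ddir_ddir_commute:
  fixes f :: "'e::euclidean_space \<Rightarrow> 'f::euclidean_space"
  assumes S: "open S" "x \<in> S" and f: "smooth_on S f"
  shows "ddir (\<lambda>y. ddir f y u) x v = ddir (\<lambda>y. ddir f y v) x u"
proof (rule euclidean_eqI)
  fix b :: 'f assume "b \<in> Basis"
  have L: "bounded_linear (\<lambda>w. w \<bullet> b)" by (rule bounded_linear_inner_left)
  have 1: "ddir (\<lambda>y. h y \<bullet> b) z w = ddir h z w \<bullet> b" if "smooth_on S h" "z \<in> S" for h z w
    using ddir_bounded_linear[OF L smooth_on_differentiable[OF that]] .
  have "ddir (\<lambda>y. ddir f y u) x v \<bullet> b = ddir (\<lambda>y. ddir (\<lambda>z. f z \<bullet> b) y u) x v" for u v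
    unfolding 1[OF smooth_on_ddir[OF f] S(2), symmetric]
    by (rule fun_cong[OF ddir_cong_open[OF S]]) (simp add: 1[OF f])
  then show "ddir (\<lambda>y. ddir f y u) x v \<bullet> b = ddir (\<lambda>y. ddir f y v) x u \<bullet> b"
    using ddir_ddir_commute_real[OF S smooth_on_bounded_linear[OF S(1) L f]] by metis
qed

subsection \<open>Maps of products\<close>

lemma
  assumes "f differentiable (at (fst p))"
  shows differentiable_fst: "(\<lambda>p. f (fst p)) differentiable (at p)"
    and ddir_fst: "ddir (\<lambda>p. f (fst p)) p u = ddir f (fst p) (fst u)"
proof -
  have "((\<lambda>p. f (fst p)) has_derivative (\<lambda>u. ddir f (fst p) (fst u))) (at p)"
    by (rule has_derivative_compose[OF bounded_linear_imp_has_derivative[OF bounded_linear_fst]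
          has_derivative_ddir[OF assms]])
  then show "(\<lambda>p. f (fst p)) differentiable (at p)"
    and "ddir (\<lambda>p. f (fst p)) p u = ddir f (fst p) (fst u)"
    by (auto intro: differentiableI simp: ddir_eqI)
qed

lemma Ck_on_fst:
  assumes "open S" "open T"
  shows "Ck_on k S f \<Longrightarrow> Ck_on k (S \<times> T) (\<lambda>p. f (fst p))"
proof (induction k arbitrary: f)
  case 0
  then show ?case
    by (auto intro!: continuous_on_compose2[of S f] continuous_intros)
next
  case (Suc k)
  have "Ck_on k (S \<times> T) (\<lambda>p. ddir (\<lambda>p. f (fst p)) p u) =
      Ck_on k (S \<times> T) (\<lambda>p. ddir f (fst p) (fst u))" for u
    by (rule Ck_on_cong[OF open_Times[OF assms]])
      (use Suc.prems in \<open>auto simp: ddir_fst\<close>)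
  moreover have "Ck_on k (S \<times> T) (\<lambda>p. ddir f (fst p) (fst u))" for u
    using Suc by auto
  ultimately show ?case using Suc.prems by (auto intro!: differentiable_fst)
qed

lemma
  assumes "f differentiable (at (snd p))"
  shows differentiable_snd: "(\<lambda>p. f (snd p)) differentiable (at p)"
    and ddir_snd: "ddir (\<lambda>p. f (snd p)) p u = ddir f (snd p) (snd u)"
proof -
  have "((\<lambda>p. f (snd p)) has_derivative (\<lambda>u. ddir f (snd p) (snd u))) (at p)"
    by (rule has_derivative_compose[OF bounded_linear_imp_has_derivative[OF bounded_linear_snd]
          has_derivative_ddir[OF assms]])
  then show "(\<lambda>p. f (snd p)) differentiable (at p)"
    and "ddir (\<lambda>p. f (snd p)) p u = ddir f (snd p) (snd u)"
    by (auto intro: differentiableI simp: ddir_eqI)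
qed

lemma Ck_on_snd:
  assumes "open S" "open T"
  shows "Ck_on k T f \<Longrightarrow> Ck_on k (S \<times> T) (\<lambda>p. f (snd p))"
proof (induction k arbitrary: f)
  case 0
  then show ?case
    by (auto intro!: continuous_on_compose2[of T f] continuous_intros)
next
  case (Suc k)
  have "Ck_on k (S \<times> T) (\<lambda>p. ddir (\<lambda>p. f (snd p)) p u) =
      Ck_on k (S \<times> T) (\<lambda>p. ddir f (snd p) (snd u))" for u
    by (rule Ck_on_cong[OF open_Times[OF assms]])
      (use Suc.prems in \<open>auto simp: ddir_snd\<close>)
  moreover have "Ck_on k (S \<times> T) (\<lambda>p. ddir f (snd p) (snd u))" for u
    using Suc by auto
  ultimately show ?case using Suc.prems by (auto intro!: differentiable_snd)
qed

lemma smooth_on_fst: "open S \<Longrightarrow> open T \<Longrightarrow> smooth_on S f \<Longrightarrow> smooth_on (S \<times> T) (\<lambda>p. f (fst p))"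
  by (simp add: smooth_on_def Ck_on_fst)

lemma smooth_on_snd: "open S \<Longrightarrow> open T \<Longrightarrow> smooth_on T f \<Longrightarrow> smooth_on (S \<times> T) (\<lambda>p. f (snd p))"
  by (simp add: smooth_on_def Ck_on_snd)

lemma smooth_on_Pair:
  assumes "open S" "smooth_on S f" "smooth_on S g"
  shows "smooth_on S (\<lambda>x. (f x, g x))"
proof -
  have "bounded_linear (\<lambda>a. (a, 0))" "bounded_linear (\<lambda>b. (0, b))"
    by (auto intro!: bounded_linear_intros)
  then have "smooth_on S (\<lambda>x. (f x, 0) + (0, g x))"
    by (intro smooth_on_add assms smooth_on_bounded_linear[OF assms(1) _ assms(2)]
        smooth_on_bounded_linear[OF assms(1) _ assms(3)])
  then show ?thesis by simp
qed

lemma ddir_Pair: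
  assumes "f differentiable (at x)" "g differentiable (at x)"
  shows "ddir (\<lambda>y. (f y, g y)) x u = (ddir f x u, ddir g x u)"
  by (subst ddir_eqI[OF has_derivative_Pair[OF has_derivative_ddir has_derivative_ddir]])
    (use assms in auto)

lemma ddir_product:
  assumes "f differentiable (at x)" "h differentiable (at y)"
  shows "ddir (\<lambda>p. (f (fst p), h (snd p))) (x, y) u = (ddir f x (fst u), ddir h y (snd u))"
  using assms by (simp add: ddir_Pair differentiable_fst differentiable_snd ddir_fst ddir_snd)

subsection \<open>Metric connections in a chart\<close>

text \<open>The torsion of \<Gamma> is left free, so that the locale covers the Levi-Civita
  connection, the characteristic connection, products of such connections and an arbitrary
  Strominger connection.\<close>

locale metric_chart =
  fixes S :: "'e::euclidean_space set" and g :: "'e \<Rightarrow> 'e \<Rightarrow> 'e \<Rightarrow> real"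
    and \<Gamma> :: "'e \<Rightarrow> 'e \<Rightarrow> 'e \<Rightarrow> 'e"
  assumes open_S: "open S"
    and bilinear_g: "x \<in> S \<Longrightarrow> bilinear (g x)"
    and g_sym: "x \<in> S \<Longrightarrow> g x u v = g x v u"
    and g_pos: "x \<in> S \<Longrightarrow> u \<noteq> 0 \<Longrightarrow> g x u u > 0"
    and smooth_g: "smooth_on S (\<lambda>x. g x u v)"
    and bilinear_\<Gamma>: "x \<in> S \<Longrightarrow> bilinear (\<Gamma> x)"
    and smooth_\<Gamma>: "smooth_on S (\<lambda>x. \<Gamma> x u v)"
    and ddir_g: "x \<in> S \<Longrightarrow> ddir (\<lambda>y. g y v w) x u = g x (\<Gamma> x u v) w + g x v (\<Gamma> x u w)"
begin

lemmas g_simps = bilinear_ladd[OF bilinear_g] bilinear_radd[OF bilinear_g]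
  bilinear_lsub[OF bilinear_g] bilinear_rsub[OF bilinear_g]
  bilinear_lneg[OF bilinear_g] bilinear_rneg[OF bilinear_g]
  bilinear_lmul[OF bilinear_g] bilinear_rmul[OF bilinear_g]
  bilinear_lzero[OF bilinear_g] bilinear_rzero[OF bilinear_g]

lemmas \<Gamma>_simps = bilinear_ladd[OF bilinear_\<Gamma>] bilinear_radd[OF bilinear_\<Gamma>]
  bilinear_lsub[OF bilinear_\<Gamma>] bilinear_rsub[OF bilinear_\<Gamma>]
  bilinear_lneg[OF bilinear_\<Gamma>] bilinear_rneg[OF bilinear_\<Gamma>]
  bilinear_lmul[OF bilinear_\<Gamma>] bilinear_rmul[OF bilinear_\<Gamma>]
  bilinear_lzero[OF bilinear_\<Gamma>] bilinear_rzero[OF bilinear_\<Gamma>]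

lemma g_eqI:
  assumes "x \<in> S" "\<And>w. g x u w = g x v w"
  shows "u = v"
proof -
  have "g x (u - v) (u - v) = 0" using assms by (simp add: g_simps)
  then show ?thesis using g_pos[of x "u - v"] assms(1) by fastforce
qed

lemma ddir_g_fields:
  assumes "x \<in> S" "smooth_on S X" "smooth_on S Y"
  shows "ddir (\<lambda>y. g y (X y) (Y y)) x u =
    g x (ddir X x u + \<Gamma> x u (X x)) (Y x) + g x (X x) (ddir Y x u + \<Gamma> x u (Y x))"
  using assms ddir_bilinear_family[OF open_S bilinear_g smooth_g assms(2,3,1), of u]
  by (simp add: ddir_g g_simps)

lemma smooth_g_fields: "smooth_on S X \<Longrightarrow> smooth_on S Y \<Longrightarrow> smooth_on S (\<lambda>y. g y (X y) (Y y))"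
  by (rule smooth_on_bilinear_family[OF open_S bilinear_g smooth_g])

lemma smooth_\<Gamma>_fields: "smooth_on S X \<Longrightarrow> smooth_on S Y \<Longrightarrow> smooth_on S (\<lambda>y. \<Gamma> y (X y) (Y y))"
  by (rule smooth_on_bilinear_family[OF open_S bilinear_\<Gamma> smooth_\<Gamma>])

end

text \<open>The algebraic core of the statement that an integrable almost Hermitian structure with closed
  fundamental form is Kaehler: \<open>B\<close> stands for $g((\nabla_X J) Y, Z)$.\<close>

lemma kaehler_vanishing:
  fixes B :: "'v::real_vector \<Rightarrow> 'v \<Rightarrow> 'v \<Rightarrow> real"
  assumes closed: "\<And>u. u \<in> H \<Longrightarrow> J u \<in> H" and J2: "\<And>u. u \<in> H \<Longrightarrow> J (J u) = - u"
    and neg: "\<And>u v w. B u (- v) w = - B u v w"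
    and skew: "\<And>u v w. B u v w = - B u w v"
    and cyclic: "\<And>u v w. u \<in> H \<Longrightarrow> v \<in> H \<Longrightarrow> w \<in> H \<Longrightarrow> B u v w + B v w u + B w u v = 0"
    and J_move: "\<And>u v w. u \<in> H \<Longrightarrow> v \<in> H \<Longrightarrow> w \<in> H \<Longrightarrow> B u (J v) w = B u v (J w)"
    and integrable: "\<And>u v w. u \<in> H \<Longrightarrow> v \<in> H \<Longrightarrow> w \<in> H \<Longrightarrow>
      B u v (J w) - B v u (J w) + B (J u) v w - B (J v) u w = 0"
    and "u \<in> H" "v \<in> H" "w \<in> H"
  shows "B u v w = 0"
proof -
  text \<open>\<open>C\<close> is symmetric in its first two and skew in its last two arguments.\<close>
  define C where "C u v w = B (J u) v w + B u v (J w)" for u v w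
  have C1: "C u v w = C v u w" if "u \<in> H" "v \<in> H" "w \<in> H" for u v w
    using integrable[OF that] by (simp add: C_def)
  have C2: "C u v w = - C u w v" if "u \<in> H" "v \<in> H" "w \<in> H" for u v w
    using J_move[OF that] skew[of "J u" v w] skew[of u "J v" w] by (simp add: C_def)
  \<comment> \<open>Alternating the symmetric swap with the skew swap three times returns to the
    start with the opposite sign.\<close>
  have C: "C u v w = 0" if "u \<in> H" "v \<in> H" "w \<in> H" for u v w
    using C1[of u v w] C1[of v w u] C1[of w u v] C2[of u v w] C2[of v w u] C2[of w u v]
      C1[of u w v] that by linarith
  have BJ: "B (J u) v w = - B u v (J w)" if "u \<in> H" "v \<in> H" "w \<in> H" for u v w
    using C[OF that] by (simp add: C_def)
  \<comment> \<open>In the sum of the two cyclic identities everything cancels except twice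
    \<open>B w (J u) v\<close>.\<close>
  have "B w (J u) v = 0" if "u \<in> H" "v \<in> H" "w \<in> H" for u v w
    using cyclic[of "J u" v w] cyclic[of u "J v" w] BJ[of u v w] BJ[of v w u]
      J_move[of u v w] J_move[of v w u] J_move[of w u v] closed that by simp
  from this[of "J v" w u] have "B u (- v) w = 0"
    using closed[OF \<open>v \<in> H\<close>] J2[OF \<open>v \<in> H\<close>] \<open>u \<in> H\<close> \<open>w \<in> H\<close> by simp
  then show ?thesis by (simp add: neg)
qed

subsection \<open>Sasakian structures in a chart\<close>

text \<open>This is \<open>sasaki_endo\<close> without the chart index, so that the local theory
  lives on a single open set.\<close>

definition reeb_endo ::
    "real \<Rightarrow> ('e::euclidean_space \<Rightarrow> 'e \<Rightarrow> 'e \<Rightarrow> 'e) \<Rightarrow> ('e \<Rightarrow> 'e) \<Rightarrow> 'e \<Rightarrow> 'e \<Rightarrow> 'e"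
  where "reeb_endo c \<Gamma> \<xi> x u = (1 / c) *\<^sub>R (ddir \<xi> x u + \<Gamma> x u (\<xi> x))"

locale sasakian_chart = metric_chart S g \<Gamma>
  for S :: "'e::euclidean_space set" and g \<Gamma> +
  fixes \<xi> :: "'e \<Rightarrow> 'e" and c :: real
  assumes \<Gamma>_sym: "x \<in> S \<Longrightarrow> \<Gamma> x u v = \<Gamma> x v u"
    and smooth_\<xi>: "smooth_on S \<xi>"
    and unit_\<xi>: "x \<in> S \<Longrightarrow> g x (\<xi> x) (\<xi> x) = 1"
    and killing: "x \<in> S \<Longrightarrow>
      ddir (\<lambda>y. g y u v) x (\<xi> x) + g x (ddir \<xi> x u) v + g x u (ddir \<xi> x v) = 0"
    and c_pos: "c > 0"
    and reeb_endo_square: "x \<in> S \<Longrightarrow> g x u (\<xi> x) = 0 \<Longrightarrow>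
      reeb_endo c \<Gamma> \<xi> x (reeb_endo c \<Gamma> \<xi> x u) = - u"
    and cr_integrable: "smooth_on S X \<Longrightarrow> smooth_on S Y \<Longrightarrow>
      (\<And>y. y \<in> S \<Longrightarrow> g y (X y) (\<xi> y) = 0 \<and> g y (Y y) (\<xi> y) = 0) \<Longrightarrow> x \<in> S \<Longrightarrow>
      bracket (\<lambda>y. reeb_endo c \<Gamma> \<xi> y (X y)) Y x + bracket X (\<lambda>y. reeb_endo c \<Gamma> \<xi> y (Y y)) x =
      reeb_endo c \<Gamma> \<xi> x (bracket X Y x -
        bracket (\<lambda>y. reeb_endo c \<Gamma> \<xi> y (X y)) (\<lambda>y. reeb_endo c \<Gamma> \<xi> y (Y y)) x)"
begin

section \<open>Pointwise identities for \<xi>, \<eta> and \<phi>\<close>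

abbreviation \<phi> where "\<phi> \<equiv> reeb_endo c \<Gamma> \<xi>"

definition \<eta> where "\<eta> x u = g x u (\<xi> x)"

lemma ddir_\<xi>: "ddir \<xi> x u = c *\<^sub>R \<phi> x u - \<Gamma> x u (\<xi> x)"
  using c_pos by (simp add: reeb_endo_def)

lemma linear_\<phi>: "x \<in> S \<Longrightarrow> linear (\<phi> x)"
  using linear_ddir[OF smooth_on_differentiable[OF smooth_\<xi>]]
  by (auto intro!: linearI simp: reeb_endo_def \<Gamma>_simps linear_add linear_scale algebra_simps)

lemmas \<phi>_simps = linear_add[OF linear_\<phi>] linear_diff[OF linear_\<phi>] linear_neg[OF linear_\<phi>]
  linear_scale[OF linear_\<phi>] linear_0[OF linear_\<phi>]

lemma smooth_\<phi>: "smooth_on S (\<lambda>x. \<phi> x u)"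
  unfolding reeb_endo_def
  by (intro smooth_on_scaleR smooth_on_add smooth_on_const open_S smooth_on_ddir smooth_\<xi>
      smooth_\<Gamma>_fields)

lemma linear_\<eta>: "x \<in> S \<Longrightarrow> linear (\<eta> x)"
  by (auto intro!: linearI simp: \<eta>_def g_simps)

lemmas \<eta>_simps = linear_add[OF linear_\<eta>] linear_diff[OF linear_\<eta>] linear_neg[OF linear_\<eta>]
  linear_scale[OF linear_\<eta>] linear_0[OF linear_\<eta>]

lemma smooth_\<eta>: "smooth_on S (\<lambda>x. \<eta> x u)"
  unfolding \<eta>_def by (intro smooth_g_fields smooth_on_const smooth_\<xi>)

lemma \<eta>_\<xi> [simp]: "x \<in> S \<Longrightarrow> \<eta> x (\<xi> x) = 1"
  by (simp add: \<eta>_def unit_\<xi>)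

text \<open>As \<Gamma> is symmetric and metric, the Lie derivative in \<open>killing\<close> equals
  g(\<nabla>_u \<xi>, v) + g(u, \<nabla>_v \<xi>).\<close>

lemma \<phi>_skew: "x \<in> S \<Longrightarrow> g x (\<phi> x u) v = - g x u (\<phi> x v)"
proof -
  assume x: "x \<in> S"
  have "c * (g x (\<phi> x u) v + g x u (\<phi> x v)) = 0"
    using killing[OF x, of u v] \<Gamma>_sym[OF x, of "\<xi> x"] x
    by (simp add: ddir_g ddir_\<xi> g_simps algebra_simps)
  then show ?thesis using c_pos by simp
qed

text \<open>The derivative of the constant length of \<xi>.\<close>

lemma \<eta>_\<phi> [simp]: "x \<in> S \<Longrightarrow> \<eta> x (\<phi> x u) = 0"
proof -
  assume x: "x \<in> S"
  have "ddir (\<lambda>y. g y (\<xi> y) (\<xi> y)) x u = ddir (\<lambda>y. 1) x u"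
    by (rule fun_cong[OF ddir_cong_open[OF open_S x]]) (rule unit_\<xi>)
  then have "2 * (c * g x (\<phi> x u) (\<xi> x)) = 0"
    using ddir_g_fields[OF x smooth_\<xi> smooth_\<xi>, of u] g_sym[OF x, of "\<xi> x"] x
    by (simp add: ddir_\<xi> g_simps)
  then show ?thesis using c_pos by (simp add: \<eta>_def)
qed

lemma \<phi>_\<xi> [simp]: "x \<in> S \<Longrightarrow> \<phi> x (\<xi> x) = 0"
proof (rule g_eqI)
  fix w assume x: "x \<in> S"
  then show "g x (\<phi> x (\<xi> x)) w = g x 0 w"
    using \<phi>_skew[OF x, of "\<xi> x" w] g_sym[OF x, of "\<xi> x" "\<phi> x w"] \<eta>_\<phi>[OF x, of w]
    by (simp add: g_simps \<eta>_def)
qed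

text \<open>Apply the horizontal relation to the horizontal part of u; \<phi> annihilates the
  remaining part.\<close>

lemma \<phi>_\<phi>: "x \<in> S \<Longrightarrow> \<phi> x (\<phi> x u) = \<eta> x u *\<^sub>R \<xi> x - u"
  using reeb_endo_square[of x "u - \<eta> x u *\<^sub>R \<xi> x"]
  by (simp add: \<phi>_simps g_simps unit_\<xi> \<eta>_def)

lemma ddir_\<eta>: "x \<in> S \<Longrightarrow> ddir (\<lambda>y. \<eta> y v) x u = \<eta> x (\<Gamma> x u v) + c * g x v (\<phi> x u)"
  using ddir_g_fields[OF _ smooth_on_const smooth_\<xi>, of x v u]
  by (simp add: \<eta>_def ddir_\<xi> g_simps)

section \<open>The Levi-Civita derivative \<open>D\<phi> x u v\<close> = (\<nabla>_u \<phi>)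
  v\<close>

definition D\<phi> where "D\<phi> x u v = ddir (\<lambda>y. \<phi> y v) x u + \<Gamma> x u (\<phi> x v) - \<phi> x (\<Gamma> x u v)"

lemma ddir_\<phi>: "ddir (\<lambda>y. \<phi> y v) x u = D\<phi> x u v - \<Gamma> x u (\<phi> x v) + \<phi> x (\<Gamma> x u v)"
  by (simp add: D\<phi>_def)

text \<open>Linearity in v uses that \<phi> is linear at all points near x, since the derivative
  sees these points.\<close>

lemma
  assumes x: "x \<in> S"
  shows linear_D\<phi>_left: "linear (\<lambda>u. D\<phi> x u v)" and linear_D\<phi>_right: "linear (\<lambda>v. D\<phi> x u v)"
proof -
  have d: "(\<lambda>y. \<phi> y v) differentiable (at x)" for v
    by (rule smooth_on_differentiable[OF smooth_\<phi> x])
  show "linear (\<lambda>u. D\<phi> x u v)"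
    using linear_ddir[OF d, of v] x
    by (auto intro!: linearI simp: D\<phi>_def \<Gamma>_simps \<phi>_simps linear_add linear_scale algebra_simps)
  have 1: "ddir (\<lambda>y. \<phi> y (v + w)) x u = ddir (\<lambda>y. \<phi> y v) x u + ddir (\<lambda>y. \<phi> y w) x u" for v w
    unfolding ddir_add[OF d d, symmetric]
    by (rule fun_cong[OF ddir_cong_open[OF open_S x]]) (simp add: \<phi>_simps)
  have 2: "ddir (\<lambda>y. \<phi> y (r *\<^sub>R v)) x u = r *\<^sub>R ddir (\<lambda>y. \<phi> y v) x u" for r v
    unfolding ddir_bounded_linear[OF bounded_linear_scaleR_right d, symmetric]
    by (rule fun_cong[OF ddir_cong_open[OF open_S x]]) (simp add: \<phi>_simps)
  show "linear (\<lambda>v. D\<phi> x u v)"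
    using x by (auto intro!: linearI simp: D\<phi>_def \<Gamma>_simps \<phi>_simps 1 2 algebra_simps)
qed

lemma bilinear_D\<phi>: "x \<in> S \<Longrightarrow> bilinear (D\<phi> x)"
  by (simp add: bilinear_def linear_D\<phi>_left linear_D\<phi>_right)

lemmas D\<phi>_simps = bilinear_ladd[OF bilinear_D\<phi>] bilinear_radd[OF bilinear_D\<phi>]
  bilinear_lsub[OF bilinear_D\<phi>] bilinear_rsub[OF bilinear_D\<phi>]
  bilinear_lneg[OF bilinear_D\<phi>] bilinear_rneg[OF bilinear_D\<phi>]
  bilinear_lmul[OF bilinear_D\<phi>] bilinear_rmul[OF bilinear_D\<phi>]

text \<open>The covariant derivative of \<open>\<phi>_skew\<close>, with g parallel.\<close>

lemma D\<phi>_skew: "x \<in> S \<Longrightarrow> g x (D\<phi> x u v) w = - g x v (D\<phi> x u w)"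
proof -
  assume x: "x \<in> S"
  have "ddir (\<lambda>y. g y (\<phi> y v) w) x u = ddir (\<lambda>y. - g y v (\<phi> y w)) x u"
    by (rule fun_cong[OF ddir_cong_open[OF open_S x]]) (rule \<phi>_skew)
  also have "\<dots> = - ddir (\<lambda>y. g y v (\<phi> y w)) x u"
    by (rule ddir_bounded_linear)
      (auto intro: bounded_linear_minus bounded_linear_ident
        smooth_on_differentiable[OF smooth_g_fields[OF smooth_on_const smooth_\<phi>] x])
  finally show ?thesis
    using ddir_g_fields[OF x smooth_\<phi> smooth_on_const, of v w u]
      ddir_g_fields[OF x smooth_on_const smooth_\<phi>, of v w u] x
    by (simp add: ddir_\<phi> g_simps \<phi>_skew)
qed

text \<open>The fundamental form $g(\varphi\cdot,\cdot)$ is a multiple of $d\eta$, hence closed.\<close>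

lemma D\<phi>_cyclic:
  assumes x: "x \<in> S"
  shows "g x (D\<phi> x u v) w + g x (D\<phi> x v w) u + g x (D\<phi> x w u) v = 0"
proof -
  let ?E = "\<lambda>v w y. ddir (\<lambda>z. \<eta> z w) y v"
  have sE: "smooth_on S (?E v w)" for v w by (rule smooth_on_ddir[OF smooth_\<eta>])
  \<comment> \<open>The right-hand side is d\<eta>(v, w), computed on constant fields.\<close>
  have 1: "(2 * c) * g y (\<phi> y v) w = ?E v w y - ?E w v y" if "y \<in> S" for v w y
    using that \<phi>_skew[OF that, of v w] \<Gamma>_sym[OF that, of v w] g_sym[OF that, of w "\<phi> y v"]
    by (simp add: ddir_\<eta> algebra_simps)
  have 2: "(2 * c) * ddir (\<lambda>y. g y (\<phi> y v) w) x u = ddir (?E v w) x u - ddir (?E w v) x u" for u v w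
  proof -
    have "(2 * c) * ddir (\<lambda>y. g y (\<phi> y v) w) x u = ddir (\<lambda>y. (2 * c) * g y (\<phi> y v) w) x u"
      by (rule ddir_bounded_linear[symmetric])
        (auto intro: bounded_linear_mult_right
          smooth_on_differentiable[OF smooth_g_fields[OF smooth_\<phi> smooth_on_const] x])
    also have "\<dots> = ddir (\<lambda>y. ?E v w y - ?E w v y) x u"
      by (rule fun_cong[OF ddir_cong_open[OF open_S x]]) (rule 1)
    also have "\<dots> = ddir (?E v w) x u - ddir (?E w v) x u"
      by (intro ddir_diff smooth_on_differentiable[OF sE x])
    finally show ?thesis .
  qed
  \<comment> \<open>Symmetry of second derivatives; it is what makes the exterior derivative of
    d\<eta> vanish.\<close>
  have 3: "ddir (?E v w) x u = ddir (?E u w) x v" for u v w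
    by (rule ddir_ddir_commute[OF open_S x smooth_\<eta>])
  have "(2 * c) * (ddir (\<lambda>y. g y (\<phi> y v) w) x u + ddir (\<lambda>y. g y (\<phi> y w) u) x v +
      ddir (\<lambda>y. g y (\<phi> y u) v) x w) = 0"
    unfolding distrib_left 2 using 3[of u v w] 3[of v w u] 3[of w u v] by linarith
  then have 4: "ddir (\<lambda>y. g y (\<phi> y v) w) x u + ddir (\<lambda>y. g y (\<phi> y w) u) x v +
      ddir (\<lambda>y. g y (\<phi> y u) v) x w = 0" using c_pos by simp
  have 5: "ddir (\<lambda>y. g y (\<phi> y v) w) x u =
      g x (D\<phi> x u v) w + g x (\<phi> x (\<Gamma> x u v)) w + g x (\<phi> x v) (\<Gamma> x u w)" for u v w
    using ddir_g_fields[OF x smooth_\<phi> smooth_on_const, of v w u] x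
    by (simp add: ddir_\<phi> g_simps)
  \<comment> \<open>By this skewness and the symmetry of \<Gamma>, the Christoffel terms cancel in
    the cyclic sum.\<close>
  have 6: "g x (\<phi> x a) b = - g x (\<phi> x b) a" for a b
    using \<phi>_skew[OF x, of a b] g_sym[OF x, of a "\<phi> x b"] by simp
  show ?thesis
    using 4 unfolding 5
    using 6[of "\<Gamma> x u v" w] 6[of "\<Gamma> x v w" u] 6[of "\<Gamma> x w u" v]
      \<Gamma>_sym[OF x, of u w] \<Gamma>_sym[OF x, of v u] \<Gamma>_sym[OF x, of w v] by simp
qed

text \<open>The covariant derivative of the identity \<open>\<phi>_\<phi>\<close>, using
  \<nabla>\<xi> = c \<phi>.\<close>

lemma D\<phi>_\<phi>:
  assumes x: "x \<in> S"
  shows "D\<phi> x u (\<phi> x v) + \<phi> x (D\<phi> x u v) = (c * g x v (\<phi> x u)) *\<^sub>R \<xi> x + (c * \<eta> x v) *\<^sub>R \<phi> x u"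
proof -
  have d: "(\<lambda>y. \<phi> y v) differentiable (at x)" for v
    by (rule smooth_on_differentiable[OF smooth_\<phi> x])
  have "ddir (\<lambda>y. \<phi> y (\<phi> x v)) x u + \<phi> x (ddir (\<lambda>y. \<phi> y v) x u) = ddir (\<lambda>y. \<phi> y (\<phi> y v)) x u"
    by (rule ddir_linear_family[OF open_S x linear_\<phi> d d, symmetric])
  also have "\<dots> = ddir (\<lambda>y. \<eta> y v *\<^sub>R \<xi> y - v) x u"
    by (rule fun_cong[OF ddir_cong_open[OF open_S x]]) (rule \<phi>_\<phi>)
  also have "\<dots> = ddir (\<lambda>y. \<eta> y v *\<^sub>R \<xi> y) x u"
    by (subst ddir_diff)
      (auto intro!: smooth_on_differentiable[OF _ x] smooth_on_scaleR open_S smooth_\<eta> smooth_\<xi>)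
  also have "\<dots> = \<eta> x v *\<^sub>R ddir \<xi> x u + ddir (\<lambda>y. \<eta> y v) x u *\<^sub>R \<xi> x"
    by (rule ddir_bounded_bilinear[OF bounded_bilinear_scaleR])
      (auto intro!: smooth_on_differentiable[OF _ x] smooth_\<eta> smooth_\<xi>)
  finally show ?thesis
    using x by (simp add: ddir_\<phi> ddir_\<xi> ddir_\<eta> \<phi>_simps \<phi>_\<phi> \<Gamma>_simps algebra_simps)
qed

text \<open>The covariant derivative of \<phi>\<xi> = 0.\<close>

lemma D\<phi>_\<xi>:
  assumes x: "x \<in> S"
  shows "D\<phi> x u (\<xi> x) = c *\<^sub>R (u - \<eta> x u *\<^sub>R \<xi> x)"
proof -
  have "ddir (\<lambda>y. \<phi> y (\<xi> x)) x u + \<phi> x (ddir \<xi> x u) = ddir (\<lambda>y. \<phi> y (\<xi> y)) x u"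
    by (rule ddir_linear_family[OF open_S x linear_\<phi>, symmetric])
      (auto intro!: smooth_on_differentiable[OF _ x] smooth_\<phi> smooth_\<xi>)
  also have "\<dots> = ddir (\<lambda>y. 0) x u"
    by (rule fun_cong[OF ddir_cong_open[OF open_S x]]) simp
  finally show ?thesis
    using x by (simp add: ddir_\<phi> ddir_\<xi> \<phi>_simps \<phi>_\<phi> \<Gamma>_simps algebra_simps)
qed

text \<open>CR integrability, applied to the horizontal projections of the constant fields \<open>u\<close> and \<open>v\<close>.\<close>

lemma D\<phi>_integrable:
  assumes x: "x \<in> S" and uv: "\<eta> x u = 0" "\<eta> x v = 0" and w: "\<eta> x w = 0"
  shows "g x (D\<phi> x u v) (\<phi> x w) - g x (D\<phi> x v u) (\<phi> x w) +
    g x (D\<phi> x (\<phi> x u) v) w - g x (D\<phi> x (\<phi> x v) u) w = 0"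
proof -
  define P where "P u y = u - \<eta> y u *\<^sub>R \<xi> y" for u y
  have sP: "smooth_on S (P u)" for u
    unfolding P_def by (intro smooth_on_diff smooth_on_scaleR smooth_on_const open_S smooth_\<eta> smooth_\<xi>)
  have hor: "g y (P u y) (\<xi> y) = 0" if "y \<in> S" for u y
    using that by (simp add: P_def g_simps unit_\<xi> \<eta>_def)
  have \<phi>P: "\<phi> y (P u y) = \<phi> y u" if "y \<in> S" for u y
    using that by (simp add: P_def \<phi>_simps)
  have Px: "P u x = u" "P v x = v" using uv by (simp_all add: P_def)
  \<comment> \<open>Since u is horizontal at x, the projected field varies there only along \<xi>.
    Such terms vanish under \<phi> and are orthogonal to \<phi> w.\<close>
  have dP: "\<exists>r. ddir (P u) x z = r *\<^sub>R \<xi> x" if "\<eta> x u = 0" for u z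
  proof -
    have "ddir (P u) x z = - ddir (\<lambda>y. \<eta> y u *\<^sub>R \<xi> y) x z"
      unfolding P_def by (subst ddir_diff)
        (auto intro!: smooth_on_differentiable[OF _ x] smooth_on_scaleR open_S smooth_\<eta> smooth_\<xi>)
    also have "ddir (\<lambda>y. \<eta> y u *\<^sub>R \<xi> y) x z = \<eta> x u *\<^sub>R ddir \<xi> x z + ddir (\<lambda>y. \<eta> y u) x z *\<^sub>R \<xi> x"
      by (rule ddir_bounded_bilinear[OF bounded_bilinear_scaleR])
        (auto intro!: smooth_on_differentiable[OF _ x] smooth_\<eta> smooth_\<xi>)
    finally show ?thesis using that by (auto intro!: exI[of _ "- ddir (\<lambda>y. \<eta> y u) x z"])
  qed
  have d\<phi>P: "ddir (\<lambda>y. \<phi> y (P u y)) x = ddir (\<lambda>y. \<phi> y u) x" for u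
    by (rule ddir_cong_open[OF open_S x]) (rule \<phi>P)
  obtain r1 r2 r3 r4 where r: "ddir (P v) x (\<phi> x u) = r1 *\<^sub>R \<xi> x" "ddir (P u) x (\<phi> x v) = r2 *\<^sub>R \<xi> x"
    "ddir (P v) x u = r3 *\<^sub>R \<xi> x" "ddir (P u) x v = r4 *\<^sub>R \<xi> x"
    using dP uv by metis
  have "(r1 *\<^sub>R \<xi> x - ddir (\<lambda>y. \<phi> y u) x v) + (ddir (\<lambda>y. \<phi> y v) x u - r2 *\<^sub>R \<xi> x) =
      \<phi> x (r3 *\<^sub>R \<xi> x - r4 *\<^sub>R \<xi> x - (ddir (\<lambda>y. \<phi> y v) x (\<phi> x u) - ddir (\<lambda>y. \<phi> y u) x (\<phi> x v)))"
    using cr_integrable[OF sP sP, of u v x] hor x unfolding bracket_def d\<phi>P \<phi>P[OF x] Px r by simp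
  then have "(r1 - r2) *\<^sub>R \<xi> x + (D\<phi> x u v - D\<phi> x v u) = - \<phi> x (D\<phi> x (\<phi> x u) v - D\<phi> x (\<phi> x v) u)
      + (\<eta> x (\<Gamma> x (\<phi> x v) u) - \<eta> x (\<Gamma> x (\<phi> x u) v)) *\<^sub>R \<xi> x"
    using x \<Gamma>_sym[OF x, of u "\<phi> x v"] \<Gamma>_sym[OF x, of v "\<phi> x u"] \<Gamma>_sym[OF x, of "\<phi> x u" "\<phi> x v"]
      \<Gamma>_sym[OF x, of u v]
    by (simp add: ddir_\<phi> \<phi>_simps \<phi>_\<phi> algebra_simps)
  \<comment> \<open>Pairing with \<phi> w removes the multiples of \<xi>; as \<phi> is isometric on
    horizontal vectors, the \<phi>-image on the right becomes a pairing with w.\<close>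
  then have "g x ((r1 - r2) *\<^sub>R \<xi> x + (D\<phi> x u v - D\<phi> x v u)) (\<phi> x w) =
      g x (- \<phi> x (D\<phi> x (\<phi> x u) v - D\<phi> x (\<phi> x v) u)
      + (\<eta> x (\<Gamma> x (\<phi> x v) u) - \<eta> x (\<Gamma> x (\<phi> x u) v)) *\<^sub>R \<xi> x) (\<phi> x w)" by simp
  moreover have "g x (\<xi> x) (\<phi> x w) = 0"
    using \<eta>_\<phi>[OF x, of w] g_sym[OF x, of "\<xi> x"] by (simp add: \<eta>_def)
  ultimately show ?thesis
    using x w by (simp add: g_simps \<phi>_skew \<phi>_\<phi>)
qed

text \<open>The trilinear form B vanishes on horizontal vectors by \<open>kaehler_vanishing\<close>.
  Its values with one argument \<xi> come from \<open>D\<phi>_\<xi>\<close> (middle slot), skewness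
  (last slot) and the cyclic identity (first slot), and these determine B.\<close>

lemma D\<phi>_formula:
  assumes x: "x \<in> S"
  shows "D\<phi> x u v = c *\<^sub>R (\<eta> x v *\<^sub>R u - g x u v *\<^sub>R \<xi> x)"
proof (rule g_eqI[OF x])
  fix w
  define B where "B u v w = g x (D\<phi> x u v) w" for u v w
  have skew: "B u v w = - B u w v" for u v w
    using D\<phi>_skew[OF x, of u v w] g_sym[OF x, of v] by (simp add: B_def)
  have hor: "B u v w = 0" if "\<eta> x u = 0" "\<eta> x v = 0" "\<eta> x w = 0" for u v w
  proof (rule kaehler_vanishing[where H = "{u. \<eta> x u = 0}" and J = "\<phi> x", of B])
    show "B u v w = - B u w v" for u v w by (rule skew)
    fix u v w assume h: "u \<in> {u. \<eta> x u = 0}" "v \<in> {u. \<eta> x u = 0}" "w \<in> {u. \<eta> x u = 0}"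
    show "B u v w + B v w u + B w u v = 0" unfolding B_def by (rule D\<phi>_cyclic[OF x])
    have "g x (D\<phi> x u (\<phi> x v) + \<phi> x (D\<phi> x u v)) w = 0"
      unfolding D\<phi>_\<phi>[OF x] using h x g_sym[OF x, of "\<xi> x"]
      by (simp add: g_simps flip: \<eta>_def)
    then show "B u (\<phi> x v) w = B u v (\<phi> x w)"
      using x by (simp add: B_def g_simps \<phi>_skew)
    show "B u v (\<phi> x w) - B v u (\<phi> x w) + B (\<phi> x u) v w - B (\<phi> x v) u w = 0"
      using D\<phi>_integrable[OF x] h by (simp add: B_def)
    show "\<phi> x u \<in> {u. \<eta> x u = 0}" "\<phi> x (\<phi> x u) = - u" using x h by (simp_all add: \<phi>_\<phi>)
  qed (use that x in \<open>simp_all add: B_def D\<phi>_simps g_simps\<close>)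
  have mid: "B u (\<xi> x) w = c * (g x u w - \<eta> x u * \<eta> x w)" for u w
    using x g_sym[OF x, of "\<xi> x"] by (simp add: B_def D\<phi>_\<xi> g_simps flip: \<eta>_def)
  have last: "B u v (\<xi> x) = - c * (g x u v - \<eta> x u * \<eta> x v)" for u v
    using mid skew[of u v "\<xi> x"] by simp
  have first: "B (\<xi> x) v w = 0" for v w
    using D\<phi>_cyclic[OF x, of "\<xi> x" v w] mid[of w v] last[of v w] g_sym[OF x, of v w]
    by (simp add: B_def mult.commute)
  define P where "P u = u - \<eta> x u *\<^sub>R \<xi> x" for u
  have P: "\<eta> x (P u) = 0" for u using x by (simp add: P_def \<eta>_simps)
  \<comment> \<open>Expanding this zero expresses B through its values with some argument equal to
    \<xi>.\<close>
  have "0 = B (P u) (P v) (P w)" using hor[OF P P P] by simp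
  also have "\<dots> = B u v w - \<eta> x u * B (\<xi> x) v w - \<eta> x v * B u (\<xi> x) w - \<eta> x w * B u v (\<xi> x)
      + \<eta> x u * \<eta> x v * B (\<xi> x) (\<xi> x) w + \<eta> x u * \<eta> x w * B (\<xi> x) v (\<xi> x)
      + \<eta> x v * \<eta> x w * B u (\<xi> x) (\<xi> x) - \<eta> x u * \<eta> x v * \<eta> x w * B (\<xi> x) (\<xi> x) (\<xi> x)"
    using x by (simp add: P_def B_def D\<phi>_simps g_simps algebra_simps)
  also have "\<dots> = B u v w - \<eta> x v * B u (\<xi> x) w - \<eta> x w * B u v (\<xi> x)
      + \<eta> x v * \<eta> x w * B u (\<xi> x) (\<xi> x)" by (simp add: first)
  also have "B u (\<xi> x) (\<xi> x) = 0" using skew[of u "\<xi> x" "\<xi> x"] by simp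
  finally have "B u v w = \<eta> x v * B u (\<xi> x) w + \<eta> x w * B u v (\<xi> x)" by simp
  then show "g x (D\<phi> x u v) w = g x (c *\<^sub>R (\<eta> x v *\<^sub>R u - g x u v *\<^sub>R \<xi> x)) w"
    using x g_sym[OF x, of "\<xi> x" w] unfolding mid last
    by (simp add: B_def g_simps algebra_simps flip: \<eta>_def)
qed

end

section \<open>Orthogonality for the metric at a point\<close>

context metric_chart
begin

text \<open>Pairing a linear relation with b isolates the coefficient of b, so nonzero orthogonal
  vectors are independent.\<close>

lemma g_orthogonal_card_le:
  assumes x: "x \<in> S" and B: "finite B" "0 \<notin> B"
    and orth: "\<And>a b. a \<in> B \<Longrightarrow> b \<in> B \<Longrightarrow> a \<noteq> b \<Longrightarrow> g x a b = 0"
  shows "card B \<le> DIM('e)"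
proof -
  have "r b = 0" if "(\<Sum>a\<in>B. r a *\<^sub>R a) = 0" "b \<in> B" for r b
  proof -
    have lin: "linear (\<lambda>a. g x a b)" using bilinear_g[OF x] by (simp add: bilinear_def)
    have "0 = g x (\<Sum>a\<in>B. r a *\<^sub>R a) b" using that x by (simp add: g_simps)
    also have "\<dots> = (\<Sum>a\<in>B. r a * g x a b)"
      by (simp add: linear_sum[OF lin] linear_scale[OF lin])
    also have "\<dots> = (\<Sum>a\<in>B. if a = b then r b * g x b b else 0)"
      by (rule sum.cong) (use orth that(2) in auto)
    also have "\<dots> = r b * g x b b" using B that(2) by simp
    finally show "r b = 0" using g_pos[OF x, of b] B(2) that(2) by fastforce
  qed
  then have "independent B" using B(1) by (auto simp: independent_explicit)
  then show ?thesis by (rule independent_bound[THEN conjunct2])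
qed

text \<open>\<open>a b\<close> represents the functional g(b, .) in the Euclidean inner product;
  fewer such vectors than the dimension have a common nonzero orthogonal vector.\<close>

lemma g_orthogonal_exists:
  assumes x: "x \<in> S" and B: "finite B" "card B < DIM('e)"
  obtains v where "v \<noteq> 0" "\<And>b. b \<in> B \<Longrightarrow> g x b v = 0"
proof -
  define a where "a b = (\<Sum>i\<in>Basis. g x b i *\<^sub>R i)" for b
  have a: "g x b v = v \<bullet> a b" for b v
  proof -
    have "g x b v = (\<Sum>i\<in>Basis. (v \<bullet> i) *\<^sub>R g x b i)"
      by (rule linear_expand_Basis) (use bilinear_g[OF x] in \<open>simp add: bilinear_def\<close>)
    then show ?thesis by (simp add: a_def inner_sum_right mult.commute)
  qed
  have "dim (a ` B) \<le> card (a ` B)" by (rule dim_le_card') (use B in simp)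
  also have "\<dots> < DIM('e)" using card_image_le[OF B(1), of a] B(2) by simp
  finally have "span (a ` B) \<noteq> UNIV" by (metis dim_UNIV dim_span less_irrefl)
  then obtain v where "v \<noteq> 0" "\<forall>y\<in>span (a ` B). v \<bullet> y = 0"
    using span_not_UNIV_orthogonal by blast
  then show ?thesis using that[of v] a by (simp add: span_base)
qed

end

subsection \<open>The characteristic connection\<close>

text \<open>Half of the torsion $\eta \wedge d\eta$ of the characteristic connection.\<close>

definition char_tensor ::
    "real \<Rightarrow> ('e::euclidean_space \<Rightarrow> 'e \<Rightarrow> 'e \<Rightarrow> real) \<Rightarrow> ('e \<Rightarrow> 'e \<Rightarrow> 'e \<Rightarrow> 'e) \<Rightarrow> ('e \<Rightarrow> 'e) \<Rightarrow>
     'e \<Rightarrow> 'e \<Rightarrow> 'e \<Rightarrow> 'e"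
  where "char_tensor c g \<Gamma> \<xi> x u v =
    c *\<^sub>R (g x u (\<xi> x) *\<^sub>R reeb_endo c \<Gamma> \<xi> x v - g x v (\<xi> x) *\<^sub>R reeb_endo c \<Gamma> \<xi> x u +
      g x (reeb_endo c \<Gamma> \<xi> x u) v *\<^sub>R \<xi> x)"

text \<open>Here d\<eta> = 2c g(\<phi>., .), so the factor c in \<open>char_tensor\<close> is what
  makes it half of \<eta> wedge d\<eta>. Adding half of a 3-form to the Levi-Civita connection keeps
  g parallel and makes that 3-form the torsion.\<close>

definition char_conn ::
    "real \<Rightarrow> ('e::euclidean_space \<Rightarrow> 'e \<Rightarrow> 'e \<Rightarrow> real) \<Rightarrow> ('e \<Rightarrow> 'e \<Rightarrow> 'e \<Rightarrow> 'e) \<Rightarrow> ('e \<Rightarrow> 'e) \<Rightarrow>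
     'e \<Rightarrow> 'e \<Rightarrow> 'e \<Rightarrow> 'e"
  where "char_conn c g \<Gamma> \<xi> x u v = \<Gamma> x u v + char_tensor c g \<Gamma> \<xi> x u v"

context sasakian_chart
begin

abbreviation A where "A \<equiv> char_tensor c g \<Gamma> \<xi>"
abbreviation \<Gamma>\<^sub>s where "\<Gamma>\<^sub>s \<equiv> char_conn c g \<Gamma> \<xi>"

lemma A_eq: "A x u v = c *\<^sub>R (\<eta> x u *\<^sub>R \<phi> x v - \<eta> x v *\<^sub>R \<phi> x u + g x (\<phi> x u) v *\<^sub>R \<xi> x)"
  by (simp add: char_tensor_def \<eta>_def)

lemma g_\<xi>_left: "x \<in> S \<Longrightarrow> g x (\<xi> x) u = \<eta> x u"
  by (simp add: \<eta>_def g_sym[of x "\<xi> x"])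

lemma g_\<xi>_right: "g x u (\<xi> x) = \<eta> x u"
  by (simp add: \<eta>_def)

lemma bilinear_A: "x \<in> S \<Longrightarrow> bilinear (A x)"
  by (auto simp: bilinear_def A_eq intro!: linearI)
    (simp_all add: \<eta>_simps \<phi>_simps g_simps algebra_simps)

lemmas A_simps = bilinear_ladd[OF bilinear_A] bilinear_radd[OF bilinear_A]
  bilinear_lneg[OF bilinear_A] bilinear_rneg[OF bilinear_A]
  bilinear_lmul[OF bilinear_A] bilinear_rmul[OF bilinear_A]

lemma smooth_A: "smooth_on S (\<lambda>x. A x u v)"
  unfolding A_eq
  by (intro smooth_on_scaleR smooth_on_add smooth_on_diff smooth_on_const open_S smooth_\<eta> smooth_\<phi>
      smooth_\<xi> smooth_g_fields)

lemma A_skew: "x \<in> S \<Longrightarrow> A x u v = - A x v u"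
  using \<phi>_skew[of x u v] g_sym[of x u "\<phi> x v"] by (simp add: A_eq algebra_simps)

text \<open>With \<open>A_skew\<close> this makes g(A u v, w) a 3-form: the reason why g stays
  parallel and why the torsion is totally skew.\<close>

lemma g_A_skew: "x \<in> S \<Longrightarrow> g x (A x u v) w = - g x (A x u w) v"
  using \<phi>_skew[of x v w] g_sym[of x v "\<phi> x w"]
  by (simp add: A_eq g_simps g_\<xi>_left algebra_simps)

lemma \<eta>_A: "x \<in> S \<Longrightarrow> \<eta> x (A x u v) = c * g x (\<phi> x u) v"
  by (simp add: A_eq \<eta>_simps)

lemma \<phi>_A: "x \<in> S \<Longrightarrow> \<phi> x (A x u v) = c *\<^sub>R (\<eta> x v *\<^sub>R u - \<eta> x u *\<^sub>R v)"
  by (simp add: A_eq \<phi>_simps \<phi>_\<phi> algebra_simps)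

section \<open>Tensors parallel for the characteristic connection\<close>

lemma metric_chart_\<Gamma>s: "metric_chart S g \<Gamma>\<^sub>s"
proof
  show "bilinear (\<Gamma>\<^sub>s x)" if "x \<in> S" for x
    using that unfolding bilinear_def char_conn_def
    by (auto intro!: linearI simp: \<Gamma>_simps A_simps algebra_simps)
  show "smooth_on S (\<lambda>x. \<Gamma>\<^sub>s x u v)" for u v
    unfolding char_conn_def by (intro smooth_on_add open_S smooth_\<Gamma> smooth_A)
  show "ddir (\<lambda>y. g y v w) x u = g x (\<Gamma>\<^sub>s x u v) w + g x v (\<Gamma>\<^sub>s x u w)" if "x \<in> S" for x u v w
    using that ddir_g[OF that, of v w u] g_A_skew[OF that, of u v w] g_sym[OF that, of v]
    by (simp add: char_conn_def g_simps)
qed (use open_S bilinear_g g_sym g_pos smooth_g in auto)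

sublocale char: metric_chart S g \<Gamma>\<^sub>s
  by (rule metric_chart_\<Gamma>s)

lemma torsion_\<Gamma>s: "x \<in> S \<Longrightarrow> \<Gamma>\<^sub>s x u v - \<Gamma>\<^sub>s x v u = 2 *\<^sub>R A x u v"
  using \<Gamma>_sym[of x u v] A_skew[of x v u] by (simp add: char_conn_def scaleR_2)

text \<open>A u \<xi> = - c \<phi> u cancels \<nabla>_u \<xi> = c \<phi> u.\<close>

lemma \<xi>_parallel: "x \<in> S \<Longrightarrow> ddir \<xi> x u = - \<Gamma>\<^sub>s x u (\<xi> x)"
  by (simp add: ddir_\<xi> char_conn_def A_eq g_\<xi>_right algebra_simps)

lemma \<eta>_parallel: "x \<in> S \<Longrightarrow> ddir (\<lambda>y. \<eta> y v) x u = \<eta> x (\<Gamma>\<^sub>s x u v)"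
  using g_sym[of x v "\<phi> x u"] by (simp add: ddir_\<eta> char_conn_def \<eta>_simps \<eta>_A)

text \<open>By \<open>D\<phi>_formula\<close>, (\<nabla>_u \<phi>) v equals \<phi> (A u v) - A u
  (\<phi> v), which is what adding A to the connection compensates.\<close>

lemma \<phi>_parallel: "x \<in> S \<Longrightarrow> ddir (\<lambda>y. \<phi> y v) x u = \<phi> x (\<Gamma>\<^sub>s x u v) - \<Gamma>\<^sub>s x u (\<phi> x v)"
  by (simp add: ddir_\<phi> D\<phi>_formula char_conn_def \<phi>_simps \<phi>_A)
    (simp add: A_eq \<phi>_skew \<phi>_\<phi> g_simps g_\<xi>_right g_\<xi>_left algebra_simps)

text \<open>A is built from g, \<eta>, \<phi> and \<xi>, all of which are parallel.\<close>

lemma A_parallel: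
  assumes x: "x \<in> S"
  shows "ddir (\<lambda>y. A y v w) x u = A x (\<Gamma>\<^sub>s x u v) w + A x v (\<Gamma>\<^sub>s x u w) - \<Gamma>\<^sub>s x u (A x v w)"
proof -
  note d = smooth_on_differentiable[OF _ x]
  have scaleR_rule: "ddir (\<lambda>y. f y *\<^sub>R X y) x u = f x *\<^sub>R ddir X x u + ddir f x u *\<^sub>R X x"
    if "smooth_on S f" "smooth_on S X" for f X
    by (rule ddir_bounded_bilinear[OF bounded_bilinear_scaleR d d]) fact+
  have s: "smooth_on S (\<lambda>y. \<eta> y v *\<^sub>R \<phi> y w)" for v w
    by (intro smooth_on_scaleR open_S smooth_\<eta> smooth_\<phi>)
  have s': "smooth_on S (\<lambda>y. g y (\<phi> y v) w)"
    by (intro smooth_g_fields smooth_\<phi> smooth_on_const)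
  have s'': "smooth_on S (\<lambda>y. g y (\<phi> y v) w *\<^sub>R \<xi> y)"
    by (intro smooth_on_scaleR open_S smooth_\<xi> s')
  have s3: "smooth_on S (\<lambda>y. \<eta> y v *\<^sub>R \<phi> y w - \<eta> y w *\<^sub>R \<phi> y v)"
    by (intro smooth_on_diff open_S s)
  have "ddir (\<lambda>y. A y v w) x u = c *\<^sub>R (ddir (\<lambda>y. \<eta> y v *\<^sub>R \<phi> y w) x u -
      ddir (\<lambda>y. \<eta> y w *\<^sub>R \<phi> y v) x u + ddir (\<lambda>y. g y (\<phi> y v) w *\<^sub>R \<xi> y) x u)"
    unfolding A_eq
    by (subst ddir_bounded_linear[OF bounded_linear_scaleR_right])
      (simp_all add: ddir_add[OF d[OF s3] d[OF s'']] ddir_diff[OF d[OF s] d[OF s]]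
        d[OF smooth_on_add[OF open_S s3 s'']])
  also have "\<dots> = A x (\<Gamma>\<^sub>s x u v) w + A x v (\<Gamma>\<^sub>s x u w) - \<Gamma>\<^sub>s x u (A x v w)"
    unfolding scaleR_rule[OF smooth_\<eta> smooth_\<phi>] scaleR_rule[OF s' smooth_\<xi>]
    using x char.ddir_g_fields[OF x smooth_\<phi> smooth_on_const, of v w u]
    by (simp add: \<eta>_parallel \<phi>_parallel \<xi>_parallel A_eq char.\<Gamma>_simps algebra_simps)
  finally show ?thesis .
qed

text \<open>The terms quadratic in \<eta> cancel in the cyclic sum, and those along \<xi> cancel by
  symmetry of g. Pairing the rest with z gives half of c^2 (F wedge F)(u, v, w, z) for F =
  g(\<phi>., .).\<close>

lemma A_cyclic:
  assumes x: "x \<in> S"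
  shows "A x (A x u v) w + A x (A x v w) u + A x (A x w u) v =
    (c * c) *\<^sub>R \<phi> x (g x (\<phi> x u) v *\<^sub>R w + g x (\<phi> x v) w *\<^sub>R u + g x (\<phi> x w) u *\<^sub>R v)"
proof -
  have AA: "A x (A x u v) w = (c * c) *\<^sub>R (g x (\<phi> x u) v *\<^sub>R \<phi> x w -
      \<eta> x w *\<^sub>R (\<eta> x v *\<^sub>R u - \<eta> x u *\<^sub>R v) + (\<eta> x v * g x u w - \<eta> x u * g x v w) *\<^sub>R \<xi> x)" for u v w
    using x by (subst A_eq) (simp add: \<eta>_A \<phi>_A g_simps algebra_simps)
  show ?thesis
    unfolding AA using x g_sym[OF x, of u w] g_sym[OF x, of v u] g_sym[OF x, of w v]
    by (simp add: \<phi>_simps algebra_simps)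
qed

text \<open>The horizontal space is at most a plane, spanned by u and \<phi> u when u is nonzero;
  with v and w written in this basis the sum inside \<phi> in \<open>A_cyclic\<close> cancels.
  General vectors reduce to their horizontal parts because the outer \<phi> annihilates
  \<xi>.\<close>

lemma A_cyclic_dim_le_3:
  assumes x: "x \<in> S" and dim: "DIM('e) \<le> 3"
  shows "A x (A x u v) w + A x (A x v w) u + A x (A x w u) v = 0"
proof -
  define P where "P u = u - \<eta> x u *\<^sub>R \<xi> x" for u
  have \<eta>P: "\<eta> x (P u) = 0" for u using x by (simp add: P_def \<eta>_simps)
  have \<phi>P: "\<phi> x (P u) = \<phi> x u" for u using x by (simp add: P_def \<phi>_simps)
  have gP: "g x (\<phi> x u) (P v) = g x (\<phi> x u) v" for u v
    using x by (simp add: P_def g_simps g_\<xi>_right)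
  \<comment> \<open>Otherwise \<xi>, u, \<phi> u and f would be four nonzero orthogonal
    vectors.\<close>
  have orth: "f = 0" if h: "\<eta> x u = 0" "\<eta> x f = 0" "u \<noteq> 0" "g x f u = 0" "g x f (\<phi> x u) = 0" for u f
  proof (rule ccontr)
    assume "f \<noteq> 0"
    have "\<phi> x u \<noteq> 0" using \<phi>_\<phi>[OF x, of u] h x by (auto simp: \<phi>_simps)
    moreover have "\<xi> x \<noteq> 0" using unit_\<xi>[OF x] x by (auto simp: g_simps)
    moreover have gu: "g x u (\<phi> x u) = 0" using \<phi>_skew[OF x, of u u] g_sym[OF x, of u] by simp
    ultimately have "card {\<xi> x, u, \<phi> x u, f} \<le> DIM('e)"
      using h \<open>f \<noteq> 0\<close> x g_sym[OF x]
      by (intro g_orthogonal_card_le[OF x]) (auto simp: g_\<xi>_left g_\<xi>_right)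
    moreover have "card {\<xi> x, u, \<phi> x u, f} = 4"
    proof -
      have "g x a a \<noteq> 0" if "a \<noteq> 0" for a using g_pos[OF x that] by simp
      moreover have "\<xi> x \<noteq> \<phi> x u" using \<eta>_\<xi>[OF x] \<eta>_\<phi>[OF x, of u] by auto
      ultimately have "\<xi> x \<noteq> u" "\<xi> x \<noteq> \<phi> x u" "\<xi> x \<noteq> f" "u \<noteq> \<phi> x u" "u \<noteq> f" "\<phi> x u \<noteq> f"
        using h \<open>f \<noteq> 0\<close> x \<open>\<phi> x u \<noteq> 0\<close> gu \<eta>_\<xi>[OF x] by auto
      then show ?thesis by simp
    qed
    ultimately show False using dim by simp
  qed
  have 2: "g x (\<phi> x u) v *\<^sub>R w + g x (\<phi> x v) w *\<^sub>R u + g x (\<phi> x w) u *\<^sub>R v = 0"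
    if h: "\<eta> x u = 0" "\<eta> x v = 0" "\<eta> x w = 0" for u v w
  proof (cases "u = 0")
    case True
    then show ?thesis using x by (simp add: \<phi>_simps g_simps)
  next
    case False
    define N where "N = g x u u"
    have N: "N \<noteq> 0" using g_pos[OF x False] by (simp add: N_def)
    have gu: "g x u (\<phi> x u) = 0" "g x (\<phi> x u) u = 0"
      using \<phi>_skew[OF x, of u u] g_sym[OF x, of u] by simp_all
    have gp: "g x (\<phi> x u) (\<phi> x u) = N"
      using \<phi>_skew[OF x, of u "\<phi> x u"] x h by (simp add: \<phi>_\<phi> g_simps N_def)
    \<comment> \<open>The remainder after projecting v to u and \<phi> u, both of squared length N,
      vanishes by \<open>orth\<close>.\<close>
    have ex: "\<exists>a b. v = a *\<^sub>R u + b *\<^sub>R \<phi> x u" if "\<eta> x v = 0" for v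
    proof -
      have "v - ((g x v u / N) *\<^sub>R u + (g x v (\<phi> x u) / N) *\<^sub>R \<phi> x u) = 0"
        by (rule orth[OF h(1) _ False])
          (use x h that N gu gp in \<open>simp_all add: \<eta>_simps g_simps flip: N_def\<close>)
      then show ?thesis by auto
    qed
    obtain a b where v: "v = a *\<^sub>R u + b *\<^sub>R \<phi> x u" using ex[OF h(2)] by auto
    obtain r s where w: "w = r *\<^sub>R u + s *\<^sub>R \<phi> x u" using ex[OF h(3)] by auto
    show ?thesis
      using x h(1) gu gp unfolding v w
      by (simp add: \<phi>_simps g_simps \<phi>_\<phi> algebra_simps flip: N_def)
  qed
  have "\<phi> x (g x (\<phi> x u) v *\<^sub>R w + g x (\<phi> x v) w *\<^sub>R u + g x (\<phi> x w) u *\<^sub>R v) =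
      \<phi> x (g x (\<phi> x (P u)) (P v) *\<^sub>R P w + g x (\<phi> x (P v)) (P w) *\<^sub>R P u +
        g x (\<phi> x (P w)) (P u) *\<^sub>R P v)"
    unfolding \<phi>P gP using x by (simp add: \<phi>_simps \<phi>P)
  also have "\<dots> = 0" using x unfolding 2[OF \<eta>P \<eta>P \<eta>P] by (simp add: \<phi>_simps)
  finally show ?thesis using A_cyclic[OF x, of u v w] by simp
qed

text \<open>On e, \<phi> e, f with f horizontal and orthogonal to the first two, only g(\<phi> e,
  \<phi> e) f survives inside \<phi>, and \<phi> is injective on horizontal vectors. Dimension above
  3 makes room for f.\<close>

lemma A_cyclic_nonzero:
  assumes x: "x \<in> S" and dim: "3 < DIM('e)"
  obtains u v w where "A x (A x u v) w + A x (A x v w) u + A x (A x w u) v \<noteq> 0"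
proof -
  obtain e where e: "e \<noteq> 0" "\<eta> x e = 0"
    using g_orthogonal_exists[OF x, of "{\<xi> x}"] dim g_\<xi>_left[OF x] by auto
  have "card {\<xi> x, e, \<phi> x e} \<le> 3" by (simp add: card_insert_if)
  then obtain f where "f \<noteq> 0" and f': "\<And>b. b \<in> {\<xi> x, e, \<phi> x e} \<Longrightarrow> g x b f = 0"
    using g_orthogonal_exists[OF x, of "{\<xi> x, e, \<phi> x e}"] dim by auto
  then have f: "f \<noteq> 0" "\<eta> x f = 0" "g x e f = 0" "g x (\<phi> x e) f = 0"
    using g_\<xi>_left[OF x] f'[of "\<xi> x"] by auto
  have nz: "\<phi> x u \<noteq> 0" if "u \<noteq> 0" "\<eta> x u = 0" for u
    using \<phi>_\<phi>[OF x, of u] that x by (auto simp: \<phi>_simps)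
  have "g x (\<phi> x e) (\<phi> x e) \<noteq> 0" using g_pos[OF x nz[OF e]] by simp
  moreover have "g x (\<phi> x (\<phi> x e)) f = 0" using x e f by (simp add: \<phi>_\<phi> g_simps)
  moreover have "g x (\<phi> x f) e = 0" using \<phi>_skew[OF x, of f e] g_sym[OF x, of f] f by simp
  ultimately have "A x (A x e (\<phi> x e)) f + A x (A x (\<phi> x e) f) e + A x (A x f e) (\<phi> x e) \<noteq> 0"
    unfolding A_cyclic[OF x] using x nz[OF f(1,2)] c_pos by (simp add: \<phi>_simps)
  then show ?thesis by (rule that)
qed

end

subsection \<open>Curvature of a metric connection\<close>

lemma torsion_eq: "torsion D i x u v = D i x u v - D i x v u"
  by (simp add: torsion_def cov_def bracket_def)

text \<open>The octahedron argument: in a combination of four cyclic identities, skewness in each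
  pair cancels all but the two terms compared.\<close>

lemma pair_symmetry:
  fixes R :: "'v \<Rightarrow> 'v \<Rightarrow> 'v \<Rightarrow> 'v \<Rightarrow> real"
  assumes "\<And>x y z w. R x y z w = - R y x z w" "\<And>x y z w. R x y z w = - R x y w z"
    and "\<And>x y z w. R x y z w + R y z x w + R z x y w = 0"
  shows "R x y z w = R z w x y"
  using assms(3)[of x y z w] assms(3)[of y z w x] assms(3)[of z w x y] assms(3)[of w x y z]
    assms(2)[of x y z w] assms(2)[of y z x w] assms(2)[of z w x y] assms(2)[of w x y z]
    assms(1)[of x z w y] assms(2)[of z x w y] assms(1)[of w y z x] assms(2)[of y w z x]
  by linarith

context metric_chart
begin

definition R where "R x u v w =
  ddir (\<lambda>y. \<Gamma> y v w) x u - ddir (\<lambda>y. \<Gamma> y u w) x v + \<Gamma> x u (\<Gamma> x v w) - \<Gamma> x v (\<Gamma> x u w)"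

definition T where "T x u v = \<Gamma> x u v - \<Gamma> x v u"

lemma curvature_R: "D i = \<Gamma> \<Longrightarrow> x \<in> S \<Longrightarrow> curvature D i x u v w = R x u v w"
proof -
  assume "D i = \<Gamma>" "x \<in> S"
  moreover from this have "cov D i (\<lambda>_. a) (\<lambda>_. b) = (\<lambda>y. \<Gamma> y a b)" for a b
    by (simp add: fun_eq_iff cov_def)
  ultimately show ?thesis
    by (simp add: curvature_def Let_def cov_def[of _ _ _ "\<lambda>y. \<Gamma> y _ _"] cov_def[of _ _ "bracket _ _"]
        bracket_def R_def \<Gamma>_simps)
qed

lemma ddir_\<Gamma>_fields:
  assumes "x \<in> S" "smooth_on S X" "smooth_on S Y"
  shows "ddir (\<lambda>y. \<Gamma> y (X y) (Y y)) x u = ddir (\<lambda>y. \<Gamma> y (X x) (Y x)) x u +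
    \<Gamma> x (ddir X x u) (Y x) + \<Gamma> x (X x) (ddir Y x u)"
  by (rule ddir_bilinear_family[OF open_S bilinear_\<Gamma> smooth_\<Gamma> assms(2,3,1)])

lemma R_skew: "R x u v w = - R x v u w"
  by (simp add: R_def)

text \<open>The Ricci identity for g: second derivatives of g(a, b) commute, and after expansion by
  \<open>ddir_g\<close> the products of first-order terms are symmetric in u and v.\<close>

lemma R_metric:
  assumes x: "x \<in> S"
  shows "g x (R x u v a) b = - g x (R x u v b) a"
proof -
  have 1: "ddir (\<lambda>y. ddir (\<lambda>z. g z a b) y v) x u =
      g x (ddir (\<lambda>y. \<Gamma> y v a) x u + \<Gamma> x u (\<Gamma> x v a)) b + g x (\<Gamma> x v a) (\<Gamma> x u b) +
      (g x (\<Gamma> x u a) (\<Gamma> x v b) + g x a (ddir (\<lambda>y. \<Gamma> y v b) x u + \<Gamma> x u (\<Gamma> x v b)))" for u v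
  proof -
    have s: "smooth_on S (\<lambda>y. g y (\<Gamma> y v a) b)" "smooth_on S (\<lambda>y. g y a (\<Gamma> y v b))"
      by (intro smooth_g_fields smooth_on_const smooth_\<Gamma>)+
    have "ddir (\<lambda>y. ddir (\<lambda>z. g z a b) y v) x u = ddir (\<lambda>y. g y (\<Gamma> y v a) b + g y a (\<Gamma> y v b)) x u"
      by (rule fun_cong[OF ddir_cong_open[OF open_S x]]) (rule ddir_g)
    also have "\<dots> = ddir (\<lambda>y. g y (\<Gamma> y v a) b) x u + ddir (\<lambda>y. g y a (\<Gamma> y v b)) x u"
      by (intro ddir_add smooth_on_differentiable[OF _ x] s)
    finally show ?thesis
      using ddir_g_fields[OF x smooth_\<Gamma> smooth_on_const, of v a b u]
        ddir_g_fields[OF x smooth_on_const smooth_\<Gamma>, of a v b u] by simp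
  qed
  have "ddir (\<lambda>y. ddir (\<lambda>z. g z a b) y v) x u = ddir (\<lambda>y. ddir (\<lambda>z. g z a b) y u) x v"
    by (rule ddir_ddir_commute[OF open_S x smooth_g])
  then show ?thesis
    using x g_sym[OF x, of a] unfolding 1 by (simp add: R_def g_simps)
qed

text \<open>The Ricci identity for J: \<open>par\<close> expresses the second derivatives of J
  through \<Gamma>, and these commute.\<close>

lemma R_parallel_endo:
  fixes J :: "'e \<Rightarrow> 'e \<Rightarrow> 'e"
  assumes x: "x \<in> S" and lin: "\<And>y. y \<in> S \<Longrightarrow> linear (J y)" and sm: "\<And>v. smooth_on S (\<lambda>y. J y v)"
    and par: "\<And>y u v. y \<in> S \<Longrightarrow> ddir (\<lambda>y. J y v) y u = J y (\<Gamma> y u v) - \<Gamma> y u (J y v)"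
  shows "R x u v (J x w) = J x (R x u v w)"
proof -
  note d = smooth_on_differentiable[OF _ x]
  have s: "smooth_on S (\<lambda>y. J y (\<Gamma> y v w))" "smooth_on S (\<lambda>y. \<Gamma> y v (J y w))" for v
    by (rule smooth_on_linear_family[OF open_S lin sm smooth_\<Gamma>], assumption)
      (rule smooth_\<Gamma>_fields[OF smooth_on_const sm])
  have 1: "ddir (\<lambda>y. ddir (\<lambda>z. J z w) y v) x u =
      J x (\<Gamma> x u (\<Gamma> x v w)) - \<Gamma> x u (J x (\<Gamma> x v w)) + J x (ddir (\<lambda>y. \<Gamma> y v w) x u) -
      (ddir (\<lambda>y. \<Gamma> y v (J x w)) x u + \<Gamma> x v (J x (\<Gamma> x u w) - \<Gamma> x u (J x w)))" for u v
  proof -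
    have "ddir (\<lambda>y. ddir (\<lambda>z. J z w) y v) x u = ddir (\<lambda>y. J y (\<Gamma> y v w) - \<Gamma> y v (J y w)) x u"
      by (rule fun_cong[OF ddir_cong_open[OF open_S x]]) (rule par)
    also have "\<dots> = ddir (\<lambda>y. J y (\<Gamma> y v w)) x u - ddir (\<lambda>y. \<Gamma> y v (J y w)) x u"
      by (intro ddir_diff d s)
    finally show ?thesis
      using ddir_linear_family[OF open_S x lin d[OF sm] d[OF smooth_\<Gamma>], of v w u]
        ddir_\<Gamma>_fields[OF x smooth_on_const sm, of v w u] x
      by (simp add: par \<Gamma>_simps)
  qed
  have "ddir (\<lambda>y. ddir (\<lambda>z. J z w) y v) x u = ddir (\<lambda>y. ddir (\<lambda>z. J z w) y u) x v"
    by (rule ddir_ddir_commute[OF open_S x sm])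
  then show ?thesis
    unfolding 1 using x lin[OF x]
    by (simp add: R_def \<Gamma>_simps linear_add linear_diff algebra_simps)
qed

text \<open>For a general connection the right-hand side also contains the cyclic sum of (\<nabla>_u
  T)(v, w); \<open>par\<close> says that \<nabla>T is zero.\<close>

lemma first_bianchi_parallel_torsion:
  assumes x: "x \<in> S"
    and par: "\<And>u v w. ddir (\<lambda>y. T y v w) x u = T x (\<Gamma> x u v) w + T x v (\<Gamma> x u w) - \<Gamma> x u (T x v w)"
  shows "R x u v w + R x v w u + R x w u v = T x (T x u v) w + T x (T x v w) u + T x (T x w u) v"
proof -
  have 1: "ddir (\<lambda>y. T y v w) x u = ddir (\<lambda>y. \<Gamma> y v w) x u - ddir (\<lambda>y. \<Gamma> y w v) x u" for u v w
    unfolding T_def by (intro ddir_diff smooth_on_differentiable[OF smooth_\<Gamma> x])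
  have "R x u v w + R x v w u + R x w u v =
      (ddir (\<lambda>y. T y v w) x u + \<Gamma> x u (T x v w)) + (ddir (\<lambda>y. T y w u) x v + \<Gamma> x v (T x w u)) +
      (ddir (\<lambda>y. T y u v) x w + \<Gamma> x w (T x u v))"
    unfolding 1 using x by (simp add: R_def T_def \<Gamma>_simps)
  also have "\<dots> = T x (T x u v) w + T x (T x v w) u + T x (T x w u) v"
    unfolding par using x by (simp add: T_def \<Gamma>_simps)
  finally show ?thesis .
qed

text \<open>Brackets are covariant derivatives minus torsion, and the covariant derivatives of J
  drop out. Integrability thus becomes a pointwise identity for the torsion.\<close>

lemma nijenhuis_torsion:
  assumes x: "x \<in> S" and lin: "linear (J i x)" and J2: "\<And>u. J i x (J i x u) = - u"
    and par: "\<And>u v. ddir (\<lambda>y. J i y v) x u = J i x (\<Gamma> x u v) - \<Gamma> x u (J i x v)"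
  shows "nijenhuis J i x u v =
    T x u v - T x (J i x u) (J i x v) + J i x (T x (J i x u) v + T x u (J i x v))"
  using lin by (simp add: nijenhuis_def bracket_def par T_def linear_add linear_diff linear_neg J2)

end

text \<open>Two metric connections with totally skew torsion that preserve \<open>J\<close> differ by a 3-form \<open>E\<close>
  with \<open>E u (J v) (J w) = E u v w\<close>, and a 3-form with this property vanishes.\<close>

lemma strominger_unique:
  assumes G: "metric_chart S g \<Gamma>" and G': "metric_chart S g \<Gamma>'" and x: "x \<in> S"
    and J2: "\<And>u. J x (J x u) = - u" and orth: "\<And>u v. g x (J x u) (J x v) = g x u v"
    and J: "\<And>u v. ddir (\<lambda>y. J y v) x u = J x (\<Gamma> x u v) - \<Gamma> x u (J x v)"
    and J': "\<And>u v. ddir (\<lambda>y. J y v) x u = J x (\<Gamma>' x u v) - \<Gamma>' x u (J x v)"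
    and lin: "linear (J x)"
    and skew: "\<And>u v w. g x (\<Gamma> x u v - \<Gamma> x v u) w = - g x (\<Gamma> x u w - \<Gamma> x w u) v"
    and skew': "\<And>u v w. g x (\<Gamma>' x u v - \<Gamma>' x v u) w = - g x (\<Gamma>' x u w - \<Gamma>' x w u) v"
  shows "\<Gamma> x u v = \<Gamma>' x u v"
proof -
  interpret G: metric_chart S g \<Gamma> by fact
  interpret G': metric_chart S g \<Gamma>' by fact
  note s = G.g_simps[OF x]
  define E where "E u v w = g x (\<Gamma> x u v - \<Gamma>' x u v) w" for u v w
  have E_metric: "E u v w = - E u w v" for u v w
    using G.ddir_g[OF x, of v w u] G'.ddir_g[OF x, of v w u] G.g_sym[OF x, of v]
    by (simp add: E_def s)
  have tor: "E u v w - E v u w = - (E u w v - E w u v)" for u v w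
    using skew[of u v w] skew'[of u v w] by (simp add: E_def s)
  \<comment> \<open>Both E and E u v w - E v u w are skew in their last two arguments; together this
    forces E to be a 3-form.\<close>
  have E12: "E u v w = - E v u w" for u v w
    using tor[of u v w] tor[of v w u] tor[of w u v] tor[of v u w] tor[of w v u] tor[of u w v]
      E_metric[of u v w] E_metric[of v w u] E_metric[of w u v] by linarith
  have EJJ: "E u (J x v) (J x w) = E u v w" for u v w
  proof -
    have "\<Gamma> x u (J x v) - \<Gamma>' x u (J x v) = J x (\<Gamma> x u v - \<Gamma>' x u v)"
      using J[of v u] J'[of v u] by (simp add: linear_diff[OF lin] algebra_simps)
    then show ?thesis by (simp add: E_def orth)
  qed
  have neg: "E u (- v) w = - E u v w" "E (- u) v w = - E u v w" for u v w
    using G.\<Gamma>_simps[OF x] G'.\<Gamma>_simps[OF x] by (simp_all add: E_def s)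
  have E13: "E u v w = - E w v u" for u v w
    using E_metric[of u v w] E12[of u w v] E_metric[of w u v] by simp
  have EJ12: "E (J x u) (J x v) w = E u v w" for u v w
    using EJJ[of w u v] E13[of w] E12 E_metric by metis
  have EJ13: "E (J x u) v (J x w) = E u v w" for u v w
    using EJ12[of u w v] E_metric[of u v w] E_metric[of "J x u" v "J x w"] by simp
  \<comment> \<open>Moving J between the arguments in two ways equates E u (J v) w with E u v (J w)
    and with its negative.\<close>
  have "E u (J x v) w = 0" for u v w
    using EJ13[of u "J x v" w] EJ12[of u v "J x w"] EJJ[of u "J x v" w] by (simp add: J2 neg)
  from this[of u "J x v"] have "E u v w = 0" for w by (simp add: J2 neg)
  then have "\<Gamma> x u v - \<Gamma>' x u v = 0"
    by (intro G.g_eqI[OF x]) (simp add: E_def s)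
  then show ?thesis by simp
qed

subsection \<open>Products in a pair of charts\<close>

text \<open>Projections replace the pattern matching of \<open>product_metric\<close>, so that
  \<open>ddir_fst\<close> and \<open>ddir_snd\<close> apply.\<close>

definition pair_metric where
  "pair_metric g1 g2 p u v = g1 (fst p) (fst u) (fst v) + g2 (snd p) (snd u) (snd v)"

definition pair_conn where
  "pair_conn \<Gamma>1 \<Gamma>2 p u v = (\<Gamma>1 (fst p) (fst u) (fst v), \<Gamma>2 (snd p) (snd u) (snd v))"

lemma product_metric_eq: "product_metric g1 g2 (i, j) = pair_metric (g1 i) (g2 j)"
  by (auto simp: product_metric_def pair_metric_def fun_eq_iff)

lemma metric_chart_pair:
  assumes "metric_chart S1 g1 \<Gamma>1" "metric_chart S2 g2 \<Gamma>2"
  shows "metric_chart (S1 \<times> S2) (pair_metric g1 g2) (pair_conn \<Gamma>1 \<Gamma>2)"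
proof -
  interpret C1: metric_chart S1 g1 \<Gamma>1 by fact
  interpret C2: metric_chart S2 g2 \<Gamma>2 by fact
  note op = open_Times[OF C1.open_S C2.open_S]
  have sg: "smooth_on (S1 \<times> S2) (\<lambda>p. g1 (fst p) u v)" "smooth_on (S1 \<times> S2) (\<lambda>p. g2 (snd p) u' v')"
    for u v u' v'
    by (intro smooth_on_fst smooth_on_snd C1.open_S C2.open_S C1.smooth_g C2.smooth_g)+
  show ?thesis
  proof
    show "open (S1 \<times> S2)" by (rule op)
    show "bilinear (pair_metric g1 g2 p)" if "p \<in> S1 \<times> S2" for p
      using that by (auto simp: bilinear_def pair_metric_def C1.g_simps C2.g_simps algebra_simps
          intro!: linearI)
    show "pair_metric g1 g2 p u v = pair_metric g1 g2 p v u" if "p \<in> S1 \<times> S2" for p u v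
      using that C1.g_sym[of "fst p" "fst u"] C2.g_sym[of "snd p" "snd u"]
      by (auto simp: pair_metric_def)
    show "0 < pair_metric g1 g2 p u u" if p: "p \<in> S1 \<times> S2" and u: "u \<noteq> 0" for p u
    proof (cases "fst u = 0")
      case True
      with u have "snd u \<noteq> 0" by (simp add: prod_eq_iff)
      with True p show ?thesis
        using C2.g_pos[of "snd p" "snd u"] by (auto simp: pair_metric_def C1.g_simps)
    next
      case False
      have "0 \<le> g2 (snd p) (snd u) (snd u)"
        using p C2.g_pos[of "snd p" "snd u"] by (cases "snd u = 0") (auto simp: C2.g_simps)
      with False p show ?thesis
        using C1.g_pos[of "fst p" "fst u"] by (auto simp: pair_metric_def)
    qed
    show "smooth_on (S1 \<times> S2) (\<lambda>p. pair_metric g1 g2 p u v)" for u v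
      unfolding pair_metric_def by (intro smooth_on_add op sg)
    show "bilinear (pair_conn \<Gamma>1 \<Gamma>2 p)" if "p \<in> S1 \<times> S2" for p
      using that by (auto simp: bilinear_def pair_conn_def C1.\<Gamma>_simps C2.\<Gamma>_simps intro!: linearI)
    show "smooth_on (S1 \<times> S2) (\<lambda>p. pair_conn \<Gamma>1 \<Gamma>2 p u v)" for u v
      unfolding pair_conn_def
      by (intro smooth_on_Pair op smooth_on_fst smooth_on_snd C1.open_S C2.open_S C1.smooth_\<Gamma> C2.smooth_\<Gamma>)
    show "ddir (\<lambda>q. pair_metric g1 g2 q v w) p u =
        pair_metric g1 g2 p (pair_conn \<Gamma>1 \<Gamma>2 p u v) w + pair_metric g1 g2 p v (pair_conn \<Gamma>1 \<Gamma>2 p u w)"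
      if p: "p \<in> S1 \<times> S2" for p u v w
    proof -
      have p': "fst p \<in> S1" "snd p \<in> S2" using p by auto
      have "ddir (\<lambda>q. pair_metric g1 g2 q v w) p u =
          ddir (\<lambda>q. g1 (fst q) (fst v) (fst w)) p u + ddir (\<lambda>q. g2 (snd q) (snd v) (snd w)) p u"
        unfolding pair_metric_def by (intro ddir_add smooth_on_differentiable[OF _ p] sg)
      also have "\<dots> = ddir (\<lambda>x. g1 x (fst v) (fst w)) (fst p) (fst u) +
          ddir (\<lambda>y. g2 y (snd v) (snd w)) (snd p) (snd u)"
        by (simp add: ddir_fst[OF smooth_on_differentiable[OF C1.smooth_g p'(1)]]
            ddir_snd[OF smooth_on_differentiable[OF C2.smooth_g p'(2)]])
      finally show ?thesis
        using p' by (simp add: C1.ddir_g C2.ddir_g pair_metric_def pair_conn_def)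
    qed
  qed
qed

section \<open>The Hermitian structure and its Strominger connection in a product chart\<close>

locale sasakian_chart_pair =
  C1: sasakian_chart S1 g1 \<Gamma>1 \<xi>1 c1 + C2: sasakian_chart S2 g2 \<Gamma>2 \<xi>2 c2
  for S1 :: "'e::euclidean_space set" and g1 \<Gamma>1 \<xi>1 c1
    and S2 :: "'f::euclidean_space set" and g2 \<Gamma>2 \<xi>2 c2
begin

abbreviation S where "S \<equiv> S1 \<times> S2"
abbreviation g where "g \<equiv> pair_metric g1 g2"
abbreviation \<Gamma> where "\<Gamma> \<equiv> pair_conn C1.\<Gamma>\<^sub>s C2.\<Gamma>\<^sub>s"

sublocale P: metric_chart S g \<Gamma>
  by (intro metric_chart_pair C1.metric_chart_\<Gamma>s C2.metric_chart_\<Gamma>s)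

definition J where "J p u =
  (C1.\<phi> (fst p) (fst u) - C2.\<eta> (snd p) (snd u) *\<^sub>R \<xi>1 (fst p),
   C2.\<phi> (snd p) (snd u) + C1.\<eta> (fst p) (fst u) *\<^sub>R \<xi>2 (snd p))"

context
  fixes p assumes p: "p \<in> S"
begin

lemma p': "fst p \<in> S1" "snd p \<in> S2"
  using p by auto

lemma linear_J: "linear (J p)"
  by (rule linearI) (simp_all add: J_def p' C1.\<phi>_simps C2.\<phi>_simps C1.\<eta>_simps C2.\<eta>_simps algebra_simps)

lemma J_J: "J p (J p u) = - u"
  by (simp add: J_def p' C1.\<phi>_simps C2.\<phi>_simps C1.\<eta>_simps C2.\<eta>_simps C1.\<phi>_\<phi> C2.\<phi>_\<phi> prod_eq_iff)

lemma g_J: "g p (J p u) (J p v) = g p u v"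
  by (simp add: J_def pair_metric_def p' C1.\<eta>_simps C2.\<eta>_simps C1.g_simps C2.g_simps C1.\<phi>_\<phi> C2.\<phi>_\<phi>
      C1.g_\<xi>_left C2.g_\<xi>_left C1.g_\<xi>_right C2.g_\<xi>_right C1.\<phi>_skew C2.\<phi>_skew)

lemma T_eq: "P.T p u v = (2 *\<^sub>R C1.A (fst p) (fst u) (fst v), 2 *\<^sub>R C2.A (snd p) (snd u) (snd v))"
  by (simp add: P.T_def pair_conn_def p' C1.torsion_\<Gamma>s C2.torsion_\<Gamma>s)

lemma T_skew: "g p (P.T p u v) w = - g p (P.T p u w) v"
  using C1.g_A_skew[OF p'(1), of "fst u" "fst v" "fst w"] C2.g_A_skew[OF p'(2), of "snd u" "snd v" "snd w"]
  by (simp add: T_eq pair_metric_def p' C1.g_simps C2.g_simps)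

text \<open>By \<open>nijenhuis_torsion\<close> the left-hand side is the Nijenhuis tensor, so this
  is the integrability of J.\<close>

lemma T_J: "P.T p u v - P.T p (J p u) (J p v) + J p (P.T p (J p u) v + P.T p u (J p v)) = 0"
  using C1.\<phi>_skew[OF p'(1), of "fst u" "fst v"] C2.\<phi>_skew[OF p'(2), of "snd u" "snd v"]
  by (simp add: T_eq J_def p' C1.A_eq C2.A_eq C1.\<phi>_simps C2.\<phi>_simps C1.\<eta>_simps C2.\<eta>_simps
      C1.g_simps C2.g_simps C1.\<phi>_\<phi> C2.\<phi>_\<phi> C1.\<phi>_skew C2.\<phi>_skew C1.g_\<xi>_left C2.g_\<xi>_left
      C1.g_\<xi>_right C2.g_\<xi>_right algebra_simps prod_eq_iff)

lemma T_parallel: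
  "ddir (\<lambda>q. P.T q v w) p u = P.T p (\<Gamma> p u v) w + P.T p v (\<Gamma> p u w) - \<Gamma> p u (P.T p v w)"
proof -
  have "ddir (\<lambda>q. P.T q v w) p u =
      ddir (\<lambda>q. 2 *\<^sub>R (C1.A (fst q) (fst v) (fst w), C2.A (snd q) (snd v) (snd w))) p u"
    by (rule fun_cong[OF ddir_cong_open[OF P.open_S p]]) (auto simp: P.T_def pair_conn_def C1.torsion_\<Gamma>s C2.torsion_\<Gamma>s)
  also have "\<dots> = 2 *\<^sub>R ddir (\<lambda>q. (C1.A (fst q) (fst v) (fst w), C2.A (snd q) (snd v) (snd w))) p u"
    by (rule ddir_bounded_linear[OF bounded_linear_scaleR_right], rule smooth_on_differentiable[OF _ p])
      (intro smooth_on_Pair P.open_S smooth_on_fst smooth_on_snd C1.open_S C2.open_S C1.smooth_A C2.smooth_A)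
  also have "\<dots> = 2 *\<^sub>R (ddir (\<lambda>x. C1.A x (fst v) (fst w)) (fst p) (fst u),
      ddir (\<lambda>y. C2.A y (snd v) (snd w)) (snd p) (snd u))"
    using ddir_product[OF smooth_on_differentiable[OF C1.smooth_A p'(1)]
        smooth_on_differentiable[OF C2.smooth_A p'(2)]] by simp
  finally show ?thesis
    by (simp add: C1.A_parallel C2.A_parallel p' T_eq pair_conn_def C1.char.\<Gamma>_simps C2.char.\<Gamma>_simps
        algebra_simps)
qed

text \<open>The mixed parts of J are products of a parallel \<eta> of one factor with a parallel
  \<xi> of the other, so J is parallel although it does not preserve the factors.\<close>

lemma J_parallel: "ddir (\<lambda>q. J q v) p u = J p (\<Gamma> p u v) - \<Gamma> p u (J p v)"
proof -
  note d1 = smooth_on_differentiable[OF _ p'(1)] and d2 = smooth_on_differentiable[OF _ p'(2)]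
  note dd = differentiable_fst[OF d1] differentiable_snd[OF d2]
  note sr = differentiable_bounded_bilinear[OF bounded_bilinear_scaleR]
    ddir_bounded_bilinear[OF bounded_bilinear_scaleR]
  let ?h1 = "\<lambda>q. C2.\<eta> (snd q) (snd v) *\<^sub>R \<xi>1 (fst q)"
  let ?h2 = "\<lambda>q. C1.\<eta> (fst q) (fst v) *\<^sub>R \<xi>2 (snd q)"
  have h: "?h1 differentiable (at p)" "?h2 differentiable (at p)"
    by (intro sr dd C1.smooth_\<eta> C2.smooth_\<eta> C1.smooth_\<xi> C2.smooth_\<xi>)+
  have "ddir ?h1 p u = C2.\<eta> (snd p) (snd v) *\<^sub>R ddir \<xi>1 (fst p) (fst u) +
      ddir (\<lambda>y. C2.\<eta> y (snd v)) (snd p) (snd u) *\<^sub>R \<xi>1 (fst p)"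
    using sr(2)[OF dd(2)[OF C2.smooth_\<eta>] dd(1)[OF C1.smooth_\<xi>]]
    by (simp add: ddir_fst[OF d1[OF C1.smooth_\<xi>]] ddir_snd[OF d2[OF C2.smooth_\<eta>]])
  moreover have "ddir ?h2 p u = C1.\<eta> (fst p) (fst v) *\<^sub>R ddir \<xi>2 (snd p) (snd u) +
      ddir (\<lambda>x. C1.\<eta> x (fst v)) (fst p) (fst u) *\<^sub>R \<xi>2 (snd p)"
    using sr(2)[OF dd(1)[OF C1.smooth_\<eta>] dd(2)[OF C2.smooth_\<xi>]]
    by (simp add: ddir_snd[OF d2[OF C2.smooth_\<xi>]] ddir_fst[OF d1[OF C1.smooth_\<eta>]])
  moreover have "ddir (\<lambda>q. J q v) p u =
      (ddir (\<lambda>x. C1.\<phi> x (fst v)) (fst p) (fst u) - ddir ?h1 p u,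
       ddir (\<lambda>y. C2.\<phi> y (snd v)) (snd p) (snd u) + ddir ?h2 p u)"
  proof -
    have "(\<lambda>q. C1.\<phi> (fst q) (fst v) - ?h1 q) differentiable (at p)"
      "(\<lambda>q. C2.\<phi> (snd q) (snd v) + ?h2 q) differentiable (at p)"
      by (intro differentiable_diff differentiable_add dd h C1.smooth_\<phi> C2.smooth_\<phi>)+
    from ddir_Pair[OF this] show ?thesis
      unfolding J_def
      by (simp add: ddir_diff[OF dd(1)[OF C1.smooth_\<phi>] h(1)] ddir_add[OF dd(2)[OF C2.smooth_\<phi>] h(2)]
          ddir_fst[OF d1[OF C1.smooth_\<phi>]] ddir_snd[OF d2[OF C2.smooth_\<phi>]])
  qed
  ultimately show ?thesis
    using p'
    by (simp add: J_def pair_conn_def C1.\<phi>_parallel C2.\<phi>_parallel C1.\<eta>_parallel C2.\<eta>_parallel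
        C1.\<xi>_parallel C2.\<xi>_parallel C1.char.\<Gamma>_simps C2.char.\<Gamma>_simps algebra_simps)
qed

end

lemma smooth_J: "smooth_on S (\<lambda>p. J p u)"
  unfolding J_def
  by (intro smooth_on_Pair smooth_on_diff smooth_on_add smooth_on_scaleR smooth_on_fst smooth_on_snd P.open_S
      C1.open_S C2.open_S C1.smooth_\<phi> C2.smooth_\<phi> C1.smooth_\<eta> C2.smooth_\<eta> C1.smooth_\<xi> C2.smooth_\<xi>)

text \<open>The torsion is 2A on each factor and enters twice, hence the 4.\<close>

lemma R_cyclic_A:
  assumes p: "p \<in> S"
  shows "P.R p u v w + P.R p v w u + P.R p w u v =
    4 *\<^sub>R (C1.A (fst p) (C1.A (fst p) (fst u) (fst v)) (fst w) + C1.A (fst p) (C1.A (fst p) (fst v) (fst w)) (fst u)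
        + C1.A (fst p) (C1.A (fst p) (fst w) (fst u)) (fst v),
      C2.A (snd p) (C2.A (snd p) (snd u) (snd v)) (snd w) + C2.A (snd p) (C2.A (snd p) (snd v) (snd w)) (snd u)
        + C2.A (snd p) (C2.A (snd p) (snd w) (snd u)) (snd v))"
  using P.first_bianchi_parallel_torsion[OF p T_parallel[OF p]] p' [OF p]
  by (simp add: T_eq[OF p] C1.A_simps C2.A_simps scaleR_add_right)

text \<open>K stands for the chart-indexed \<open>standard_J\<close>; agreement with J on the open
  set S carries over to derivatives.\<close>

lemma nijenhuis_J:
  assumes p: "p \<in> S" and K: "\<And>q. q \<in> S \<Longrightarrow> K i q = J q"
  shows "nijenhuis K i p u v = 0"
proof -
  have "ddir (\<lambda>q. K i q v) p = ddir (\<lambda>q. J q v) p" for v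
    by (rule ddir_cong_open[OF P.open_S p]) (simp add: K)
  then have "nijenhuis K i p u v = P.T p u v - P.T p (K i p u) (K i p v)
      + K i p (P.T p (K i p u) v + P.T p u (K i p v))"
    by (intro P.nijenhuis_torsion) (simp_all add: K p linear_J J_J J_parallel)
  then show ?thesis using T_J[OF p] by (simp add: K p)
qed

end

subsection \<open>Changes of coordinates\<close>

lemma
  assumes "smooth_manifold M" "i \<in> charts M"
  shows chart_img_open: "open (chart_img M i)"
    and chart_dom_open: "open (chart_dom M i)"
    and chart_homeomorphism:
      "homeomorphism (chart_dom M i) (chart_img M i) (chart_map M i) (chart_inv M i)"
  using assms by (auto simp: smooth_manifold_def)

lemma
  assumes M: "smooth_manifold M" and i: "i \<in> charts M"
  shows chart_inv_map: "a \<in> chart_dom M i \<Longrightarrow> chart_inv M i (chart_map M i a) = a"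
    and chart_map_inj: "inj_on (chart_map M i) (chart_dom M i)"
  using chart_homeomorphism[OF assms] by (auto simp: homeomorphism_def intro: inj_on_inverseI)

lemma overlap_subset: "overlap M i j \<subseteq> chart_img M i"
  by (auto simp: overlap_def chart_img_def)

lemma
  assumes M: "smooth_manifold M" and i: "i \<in> charts M" and j: "j \<in> charts M"
  shows overlap_open: "open (overlap M i j)"
    and trans_map_in_img: "x \<in> overlap M i j \<Longrightarrow> trans_map M i j x \<in> chart_img M j"
    and trans_map_smooth: "smooth_on (overlap M i j) (trans_map M i j)"
proof -
  have "openin (top_of_set (chart_dom M i)) (chart_dom M i \<inter> chart_dom M j)"
    by (rule openin_open_Int[OF chart_dom_open[OF M j]])
  from homeomorphism_imp_open_map[OF chart_homeomorphism[OF M i] this]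
  show "open (overlap M i j)"
    unfolding overlap_def by (rule openin_open_trans) (rule chart_img_open[OF M i])
  show "x \<in> overlap M i j \<Longrightarrow> trans_map M i j x \<in> chart_img M j"
    by (auto simp: overlap_def trans_map_def chart_inv_map[OF M i] chart_img_def)
  show "smooth_on (overlap M i j) (trans_map M i j)"
    using assms by (simp add: smooth_manifold_def)
qed

lemma sasaki_endo_eq: "sasaki_endo c D \<xi> i = reeb_endo c (D i) (\<xi> i)"
  by (simp add: fun_eq_iff sasaki_endo_def reeb_endo_def cov_def)

lemma metric_chart_manifold:
  assumes "smooth_manifold M" "riemannian_metric M g" "affine_connection M D"
    "metric_connection M g D" "i \<in> charts M"
  shows "metric_chart (chart_img M i) (g i) (D i)"
  using assms chart_img_open[OF assms(1,5)]
  unfolding metric_chart_def riemannian_metric_def affine_connection_def metric_connection_def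
    cov_def by simp

lemma sasakian_chart_manifold:
  assumes s: "sasakian m c N g D \<xi>" and i: "i \<in> charts N"
  shows "sasakian_chart (chart_img N i) (g i) (D i) (\<xi> i) c"
proof -
  have *: "smooth_manifold N" "riemannian_metric N g" "affine_connection N D"
    "metric_connection N g D"
    using s by (auto simp: sasakian_def levi_civita_def)
  interpret metric_chart "chart_img N i" "g i" "D i"
    by (rule metric_chart_manifold[OF * i])
  show ?thesis
  proof
    fix x assume x: "x \<in> chart_img N i"
    show "D i x u v = D i x v u" for u v
      using s i x by (auto simp: sasakian_def levi_civita_def torsion_eq)
    show "g i x (\<xi> i x) (\<xi> i x) = 1" using s i x by (auto simp: sasakian_def)
    show "ddir (\<lambda>y. g i y u v) x (\<xi> i x) + g i x (ddir (\<xi> i) x u) v + g i x u (ddir (\<xi> i) x v) = 0"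
      for u v using s i x by (auto simp: sasakian_def killing_field_def)
    show "g i x u (\<xi> i x) = 0 \<Longrightarrow>
        reeb_endo c (D i) (\<xi> i) x (reeb_endo c (D i) (\<xi> i) x u) = - u" for u
      using s i x by (auto simp: sasakian_def horizontal_def sasaki_endo_eq Let_def)
    fix X Y
    assume XY: "smooth_on (chart_img N i) X" "smooth_on (chart_img N i) Y"
      "\<And>y. y \<in> chart_img N i \<Longrightarrow> g i y (X y) (\<xi> i y) = 0 \<and> g i y (Y y) (\<xi> i y) = 0"
    have "integrable_on_distribution N (horizontal g \<xi>) (sasaki_endo c D \<xi>)"
      using s by (simp add: sasakian_def Let_def)
    then show "bracket (\<lambda>y. reeb_endo c (D i) (\<xi> i) y (X y)) Y x +
        bracket X (\<lambda>y. reeb_endo c (D i) (\<xi> i) y (Y y)) x =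
        reeb_endo c (D i) (\<xi> i) x (bracket X Y x -
        bracket (\<lambda>y. reeb_endo c (D i) (\<xi> i) y (X y)) (\<lambda>y. reeb_endo c (D i) (\<xi> i) y (Y y)) x)"
      using i x XY by (auto simp: integrable_on_distribution_def Let_def horizontal_def sasaki_endo_eq)
  next
    show "smooth_on (chart_img N i) (\<xi> i)" using s i by (auto simp: sasakian_def vector_field_def)
    show "c > 0" using s by (auto simp: sasakian_def)
  qed
qed

section \<open>Transformation of \<phi> and of the characteristic connection\<close>

context
  fixes m c N and g :: "('i, 'e::euclidean_space) metric" and D \<xi> i j x
  assumes s: "sasakian m c N g D \<xi>" and i: "i \<in> charts N" and j: "j \<in> charts N"
    and x: "x \<in> overlap N i j"
begin

private abbreviation "\<tau> \<equiv> trans_map N i j"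

private lemma N: "smooth_manifold N" "vector_field N \<xi>" "riemannian_metric N g" "affine_connection N D"
  using s by (auto simp: sasakian_def levi_civita_def)

private lemmas \<tau>_smooth = trans_map_smooth[OF N(1) i j]
private lemmas \<tau>_diff = smooth_on_differentiable[OF \<tau>_smooth x]
private lemmas op = overlap_open[OF N(1) i j]

private lemma \<tau>_linear: "y \<in> overlap N i j \<Longrightarrow> linear (ddir \<tau> y)"
  by (rule linear_ddir[OF smooth_on_differentiable[OF \<tau>_smooth]])

private lemmas lin = linear_add[OF \<tau>_linear[OF x]] linear_scale[OF \<tau>_linear[OF x]]
  linear_diff[OF \<tau>_linear[OF x]]

private lemma \<xi>_trans: "y \<in> overlap N i j \<Longrightarrow> \<xi> j (\<tau> y) = ddir \<tau> y (\<xi> i y)"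
  using N(2) i j by (auto simp: vector_field_def)

lemma metric_trans: "g j (\<tau> x) (ddir \<tau> x u) (ddir \<tau> x v) = g i x u v"
  using N(3) i j x by (auto simp: riemannian_metric_def)

private lemma D_trans: "ddir \<tau> x (D i x u v) =
    ddir (\<lambda>y. ddir \<tau> y v) x u + D j (\<tau> x) (ddir \<tau> x u) (ddir \<tau> x v)"
  using N(4) i j x by (auto simp: affine_connection_def)

text \<open>The second derivative of the transition map appears in the transformation of d\<xi> and,
  with opposite sign, in that of the Christoffel symbols; it cancels in \<nabla>\<xi>.\<close>

lemma reeb_endo_trans:
  "reeb_endo c (D j) (\<xi> j) (\<tau> x) (ddir \<tau> x u) = ddir \<tau> x (reeb_endo c (D i) (\<xi> i) x u)"
proof -
  interpret I: sasakian_chart "chart_img N i" "g i" "D i" "\<xi> i" c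
    by (rule sasakian_chart_manifold[OF s i])
  interpret J: sasakian_chart "chart_img N j" "g j" "D j" "\<xi> j" c
    by (rule sasakian_chart_manifold[OF s j])
  have dj: "\<xi> j differentiable (at (\<tau> x))"
    by (rule smooth_on_differentiable[OF J.smooth_\<xi> trans_map_in_img[OF N(1) i j x]])
  have di: "\<xi> i differentiable (at x)"
    by (rule smooth_on_differentiable[OF I.smooth_\<xi> subsetD[OF overlap_subset x]])
  have "((\<lambda>y. \<xi> j (\<tau> y)) has_derivative (\<lambda>u. ddir (\<xi> j) (\<tau> x) (ddir \<tau> x u))) (at x)"
    by (rule has_derivative_compose[OF has_derivative_ddir[OF \<tau>_diff] has_derivative_ddir[OF dj]])
  then have "ddir (\<xi> j) (\<tau> x) (ddir \<tau> x u) = ddir (\<lambda>y. \<xi> j (\<tau> y)) x u"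
    by (simp add: ddir_eqI)
  also have "\<dots> = ddir (\<lambda>y. ddir \<tau> y (\<xi> i y)) x u"
    by (rule fun_cong[OF ddir_cong_open[OF op x]]) (rule \<xi>_trans)
  also have "\<dots> = ddir (\<lambda>y. ddir \<tau> y (\<xi> i x)) x u + ddir \<tau> x (ddir (\<xi> i) x u)"
    by (rule ddir_linear_family[OF op x \<tau>_linear _ di], assumption)
      (rule smooth_on_differentiable[OF smooth_on_ddir[OF \<tau>_smooth] x])
  finally show ?thesis
    using D_trans[of u "\<xi> i x"] by (simp add: reeb_endo_def lin \<xi>_trans[OF x])
qed

lemma char_tensor_trans:
  "char_tensor c (g j) (D j) (\<xi> j) (\<tau> x) (ddir \<tau> x u) (ddir \<tau> x v) =
    ddir \<tau> x (char_tensor c (g i) (D i) (\<xi> i) x u v)"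
  by (simp add: char_tensor_def reeb_endo_trans \<xi>_trans[OF x] metric_trans lin)

text \<open>A connection plus a tensor field transforms as a connection.\<close>

lemma char_conn_trans:
  "ddir \<tau> x (char_conn c (g i) (D i) (\<xi> i) x u v) = ddir (\<lambda>y. ddir \<tau> y v) x u +
    char_conn c (g j) (D j) (\<xi> j) (\<tau> x) (ddir \<tau> x u) (ddir \<tau> x v)"
  by (simp add: char_conn_def lin D_trans char_tensor_trans)

lemma reeb_trans: "\<xi> j (\<tau> x) = ddir \<tau> x (\<xi> i x)"
  by (rule \<xi>_trans[OF x])

end

subsection \<open>Product manifolds\<close>

lemma charts_product: "charts (product_atlas M N) = charts M \<times> charts N"
  by (simp add: product_atlas_def)

lemma chart_img_product: "chart_img (product_atlas M N) (i, j) = chart_img M i \<times> chart_img N j"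
  by (simp add: chart_img_def product_atlas_def map_prod_surj_on)

lemma overlap_product:
  "overlap (product_atlas M N) (i, j) (i', j') = overlap M i i' \<times> overlap N j j'"
  by (simp add: overlap_def product_atlas_def Times_Int_Times map_prod_surj_on)

context
  fixes M :: "('i, 'a::{t2_space,second_countable_topology}, 'e::euclidean_space) atlas"
    and N :: "('j, 'b::{t2_space,second_countable_topology}, 'f::euclidean_space) atlas"
  assumes M: "smooth_manifold M" and N: "smooth_manifold N"
begin

text \<open>\<open>chart_inv\<close> is an \<open>inv_into\<close>; injectivity of the product chart
  pins down its value at an image point.\<close>

lemma chart_inv_product:
  assumes "i \<in> charts M" "j \<in> charts N" "p \<in> chart_img M i \<times> chart_img N j"
  shows "chart_inv (product_atlas M N) (i, j) p = (chart_inv M i (fst p), chart_inv N j (snd p))"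
proof -
  obtain a b where p: "p = (chart_map M i a, chart_map N j b)" "a \<in> chart_dom M i" "b \<in> chart_dom N j"
    using assms(3) by (auto simp: chart_img_def)
  have "inj_on (map_prod (chart_map M i) (chart_map N j)) (chart_dom M i \<times> chart_dom N j)"
    by (intro map_prod_inj_on chart_map_inj M N assms)
  then have "inv_into (chart_dom M i \<times> chart_dom N j) (map_prod (chart_map M i) (chart_map N j))
      (map_prod (chart_map M i) (chart_map N j) (a, b)) = (a, b)"
    by (rule inv_into_f_f) (use p in simp)
  then have "chart_inv (product_atlas M N) (i, j) p = (a, b)"
    by (simp add: chart_inv_def product_atlas_def p)
  then show ?thesis
    using p by (simp add: chart_inv_map[OF M assms(1)] chart_inv_map[OF N assms(2)])
qed

lemma trans_map_product:
  assumes "i \<in> charts M" "j \<in> charts N" "p \<in> overlap M i i' \<times> overlap N j j'"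
  shows "trans_map (product_atlas M N) (i, j) (i', j') p =
    (trans_map M i i' (fst p), trans_map N j j' (snd p))"
proof -
  have "p \<in> chart_img M i \<times> chart_img N j" using assms(3) overlap_subset[of M i i'] overlap_subset[of N j j'] by auto
  then show ?thesis
    using chart_inv_product[OF assms(1,2)] by (simp add: trans_map_def product_atlas_def)
qed

lemma trans_map_product_smooth:
  assumes "i \<in> charts M" "j \<in> charts N" "i' \<in> charts M" "j' \<in> charts N"
  shows "smooth_on (overlap M i i' \<times> overlap N j j') (trans_map (product_atlas M N) (i, j) (i', j'))"
proof -
  note op = overlap_open[OF M assms(1,3)] overlap_open[OF N assms(2,4)]
  have "smooth_on (overlap M i i' \<times> overlap N j j')
      (\<lambda>p. (trans_map M i i' (fst p), trans_map N j j' (snd p)))"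
    by (intro smooth_on_Pair open_Times op smooth_on_fst smooth_on_snd trans_map_smooth M N assms)
  then show ?thesis
    by (subst smooth_on_cong[OF open_Times[OF op]]) (simp_all add: trans_map_product assms)
qed

lemma ddir_trans_map_product:
  assumes "i \<in> charts M" "j \<in> charts N" "i' \<in> charts M" "j' \<in> charts N"
    and p: "p \<in> overlap M i i' \<times> overlap N j j'"
  shows "ddir (trans_map (product_atlas M N) (i, j) (i', j')) p u =
    (ddir (trans_map M i i') (fst p) (fst u), ddir (trans_map N j j') (snd p) (snd u))"
proof -
  note op = overlap_open[OF M assms(1,3)] overlap_open[OF N assms(2,4)]
  have "ddir (trans_map (product_atlas M N) (i, j) (i', j')) p u =
      ddir (\<lambda>p. (trans_map M i i' (fst p), trans_map N j j' (snd p))) p u"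
    by (rule fun_cong[OF ddir_cong_open[OF open_Times[OF op] p]]) (simp add: trans_map_product assms)
  then show ?thesis
    using ddir_product[OF smooth_on_differentiable[OF trans_map_smooth[OF M assms(1,3)]]
        smooth_on_differentiable[OF trans_map_smooth[OF N assms(2,4)]], of "fst p" "snd p" u] p by (simp add: mem_Times_iff)
qed

text \<open>These second derivatives are the inhomogeneous term in the transformation law of the
  product connection.\<close>

lemma ddir_ddir_trans_map_product:
  assumes "i \<in> charts M" "j \<in> charts N" "i' \<in> charts M" "j' \<in> charts N"
    and p: "p \<in> overlap M i i' \<times> overlap N j j'"
  shows "ddir (\<lambda>q. ddir (trans_map (product_atlas M N) (i, j) (i', j')) q v) p u =
    (ddir (\<lambda>y. ddir (trans_map M i i') y (fst v)) (fst p) (fst u),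
     ddir (\<lambda>y. ddir (trans_map N j j') y (snd v)) (snd p) (snd u))"
proof -
  note op = overlap_open[OF M assms(1,3)] overlap_open[OF N assms(2,4)]
  have "ddir (\<lambda>q. ddir (trans_map (product_atlas M N) (i, j) (i', j')) q v) p u =
      ddir (\<lambda>q. (ddir (trans_map M i i') (fst q) (fst v), ddir (trans_map N j j') (snd q) (snd v))) p u"
    by (rule fun_cong[OF ddir_cong_open[OF open_Times[OF op] p]])
      (rule ddir_trans_map_product[OF assms(1-4)])
  then show ?thesis
    using ddir_product[OF smooth_on_differentiable[OF smooth_on_ddir[OF trans_map_smooth[OF M assms(1,3)]]]
        smooth_on_differentiable[OF smooth_on_ddir[OF trans_map_smooth[OF N assms(2,4)]]],
        where x = "fst p" and y = "snd p"] p by (simp add: mem_Times_iff)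
qed

lemma smooth_manifold_product: "smooth_manifold (product_atlas M N)"
  unfolding smooth_manifold_def charts_product
proof (intro conjI ballI)
  show "points (product_atlas M N) \<noteq> {}"
    using M N by (force simp: smooth_manifold_def points_def product_atlas_def)
next
  fix k assume "k \<in> charts M \<times> charts N"
  then obtain i j where k: "k = (i, j)" and i: "i \<in> charts M" and j: "j \<in> charts N" by auto
  note hM = chart_homeomorphism[OF M i, unfolded homeomorphism_def]
    and hN = chart_homeomorphism[OF N j, unfolded homeomorphism_def]
  have dom: "chart_dom (product_atlas M N) k = chart_dom M i \<times> chart_dom N j"
    and map: "chart_map (product_atlas M N) k = (\<lambda>a. (chart_map M i (fst a), chart_map N j (snd a)))"
    by (auto simp: k product_atlas_def)
  have img: "chart_img (product_atlas M N) k = chart_img M i \<times> chart_img N j"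
    by (simp add: k chart_img_product)
  show "open (chart_dom (product_atlas M N) k)" "open (chart_img (product_atlas M N) k)"
    unfolding dom img by (intro open_Times chart_dom_open chart_img_open M N i j)+
  have inv: "chart_inv (product_atlas M N) k p = (chart_inv M i (fst p), chart_inv N j (snd p))"
    if "p \<in> chart_img M i \<times> chart_img N j" for p
    unfolding k by (rule chart_inv_product[OF i j that])
  have "homeomorphism (chart_dom M i \<times> chart_dom N j) (chart_img M i \<times> chart_img N j)
      (\<lambda>a. (chart_map M i (fst a), chart_map N j (snd a)))
      (\<lambda>p. (chart_inv M i (fst p), chart_inv N j (snd p)))"
    by (rule homeomorphismI)
      (use hM hN in \<open>auto intro!: continuous_on_Pair continuous_on_compose2[of _ _ _ fst]
        continuous_on_compose2[of _ _ _ snd] continuous_intros\<close>)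
  then show "homeomorphism (chart_dom (product_atlas M N) k) (chart_img (product_atlas M N) k)
      (chart_map (product_atlas M N) k) (chart_inv (product_atlas M N) k)"
    unfolding dom img map by (rule homeomorphism_cong) (simp_all add: inv)
  fix k' assume "k' \<in> charts M \<times> charts N"
  then obtain i' j' where k': "k' = (i', j')" and i': "i' \<in> charts M" and j': "j' \<in> charts N" by auto
  show "smooth_on (overlap (product_atlas M N) k k') (trans_map (product_atlas M N) k k')"
    unfolding k k' overlap_product by (rule trans_map_product_smooth[OF i j i' j'])
qed

end

subsection \<open>The Kaehler-like condition\<close>

lemma parallel_endo_ddir:
  assumes "parallel_endo M J D" "i \<in> charts M" "x \<in> chart_img M i"
  shows "ddir (\<lambda>y. J i y v) x u = J i x (D i x u v) - D i x u (J i x v)"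
proof -
  have "cov D i (\<lambda>_. u) (\<lambda>y. J i y v) x = J i x (cov D i (\<lambda>_. u) (\<lambda>_. v) x)"
    using assms unfolding parallel_endo_def by blast
  then show ?thesis by (simp add: cov_def algebra_simps)
qed

text \<open>The cyclic identity is the only condition to check: it yields the pair symmetry of the
  curvature, which turns \<open>J\<close>-invariance in the last two arguments into invariance in the first two.\<close>

lemma strominger_kahler_likeI:
  assumes H: "hermitian_manifold M g J" and D: "strominger_connection M g J D"
    and cyclic: "\<And>i p x y z. i \<in> charts M \<Longrightarrow> p \<in> chart_img M i \<Longrightarrow>
      curvature D i p x y z + curvature D i p y z x + curvature D i p z x y = 0"
  shows "strominger_kahler_like M g J"
proof -
  have "let R = (\<lambda>x y z w. g i p (curvature D i p x y z) w); Jp = J i p in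
      R x y z w + R y z x w + R z x y w = 0 \<and> R x y z w = R (Jp x) (Jp y) z w \<and>
      R x y z w = R x y (Jp z) (Jp w)"
    if i: "i \<in> charts M" and p: "p \<in> chart_img M i" for i p x y z w
  proof -
    interpret metric_chart "chart_img M i" "g i" "D i"
      by (rule metric_chart_manifold[OF _ _ _ _ i])
        (use H D in \<open>auto simp: hermitian_manifold_def strominger_connection_def\<close>)
    have curv: "curvature D i p x y z = R p x y z" for x y z
      by (rule curvature_R[of D i, OF refl p])
    define Q where "Q x y z w = g i p (R p x y z) w" for x y z w
    have cyc: "Q x y z w + Q y z x w + Q z x y w = 0" for x y z w
      using arg_cong[OF cyclic[OF i p, of x y z], of "\<lambda>u. g i p u w"] p
      unfolding curv Q_def by (simp add: g_simps)
    have sym: "Q x y z w = Q z w x y" for x y z w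
    proof (rule pair_symmetry[of Q])
      show "Q x y z w = - Q y x z w" for x y z w
        using R_skew[of p x y z] p by (simp add: Q_def g_simps)
      show "Q x y z w = - Q x y w z" for x y z w
        unfolding Q_def by (rule R_metric[OF p])
      show "Q x y z w + Q y z x w + Q z x y w = 0" for x y z w
        by (rule cyc)
    qed
    have "R p x y (J i p z) = J i p (R p x y z)" for x y z
      by (rule R_parallel_endo[OF p])
        (use H D i in \<open>auto simp: hermitian_manifold_def endomorphism_field_def
          strominger_connection_def intro!: parallel_endo_ddir\<close>)
    moreover have "g i p (J i p u) (J i p v) = g i p u v" for u v
      using H i p by (auto simp: hermitian_manifold_def)
    ultimately have inv: "Q x y (J i p z) (J i p w) = Q x y z w" for x y z w
      by (simp add: Q_def)
    have "Q x y z w = Q (J i p x) (J i p y) z w"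
      using sym[of "J i p x" "J i p y" z w] inv[of z w x y] sym[of z w x y] by simp
    then show ?thesis
      using inv[of x y z w] cyc[of x y z w] unfolding Let_def curv Q_def[symmetric] by metis
  qed
  then show ?thesis unfolding strominger_kahler_like_def using H D by blast
qed

text \<open>\<open>standard_J\<close> applies \<phi> to horizontal parts, \<open>J\<close> to whole
  vectors; they agree because \<phi>\<xi> = 0. The equations for the index families let the
  chart-level facts be used for globally given fields.\<close>

lemma (in sasakian_chart_pair) standard_J_eq:
  assumes "p \<in> S" "h1 i = g1" "h2 j = g2" "E1 i = \<Gamma>1" "E2 j = \<Gamma>2" "\<zeta>1 i = \<xi>1" "\<zeta>2 j = \<xi>2"
  shows "standard_J c1 c2 h1 h2 E1 E2 \<zeta>1 \<zeta>2 (i, j) p = J p"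
proof
  fix u
  show "standard_J c1 c2 h1 h2 E1 E2 \<zeta>1 \<zeta>2 (i, j) p u = J p u"
    using assms(1)
    by (simp add: standard_J_def J_def Let_def case_prod_beta sasaki_endo_eq assms(2-) mem_Times_iff
        C1.\<phi>_simps C2.\<phi>_simps C1.g_\<xi>_right C2.g_\<xi>_right)
qed

section \<open>The product of two Sasakian manifolds\<close>

locale sasakian_product =
  fixes M :: "('i, 'a::{t2_space,second_countable_topology}, 'e::euclidean_space) atlas"
    and N :: "('j, 'b::{t2_space,second_countable_topology}, 'f::euclidean_space) atlas"
    and g1 :: "('i, 'e) metric" and g2 :: "('j, 'f) metric"
    and D1 :: "('i, 'e) connection" and D2 :: "('j, 'f) connection"
    and \<xi>1 :: "('i, 'e) vec_field" and \<xi>2 :: "('j, 'f) vec_field"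
    and c1 c2 :: real and m1 m2 :: nat
  assumes s1: "sasakian m1 c1 M g1 D1 \<xi>1" and s2: "sasakian m2 c2 N g2 D2 \<xi>2"
begin

abbreviation "MN \<equiv> product_atlas M N"
abbreviation "G \<equiv> product_metric g1 g2"
abbreviation "K \<equiv> standard_J c1 c2 g1 g2 D1 D2 \<xi>1 \<xi>2"
abbreviation "B1 i \<equiv> char_conn c1 (g1 i) (D1 i) (\<xi>1 i)"
abbreviation "B2 j \<equiv> char_conn c2 (g2 j) (D2 j) (\<xi>2 j)"

definition B where "B = (\<lambda>(i, j). pair_conn (B1 i) (B2 j))"

lemma M: "smooth_manifold M" and N: "smooth_manifold N"
  and g1: "riemannian_metric M g1" and g2: "riemannian_metric N g2"
  using s1 s2 by (auto simp: sasakian_def)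

lemma chart_pair:
  assumes "i \<in> charts M" "j \<in> charts N"
  shows "sasakian_chart_pair (chart_img M i) (g1 i) (D1 i) (\<xi>1 i) c1
    (chart_img N j) (g2 j) (D2 j) (\<xi>2 j) c2"
  unfolding sasakian_chart_pair_def
  using sasakian_chart_manifold[OF s1 assms(1)] sasakian_chart_manifold[OF s2 assms(2)] by simp

lemma ball_charts: "(\<forall>k\<in>charts MN. P k) \<longleftrightarrow> (\<forall>i\<in>charts M. \<forall>j\<in>charts N. P (i, j))"
  by (auto simp: charts_product)

lemma riemannian_metric_product: "riemannian_metric MN G"
  unfolding riemannian_metric_def ball_charts chart_img_product overlap_product product_metric_eq
proof (intro conjI ballI allI impI)
  fix i j assume ij: "i \<in> charts M" "j \<in> charts N"
  interpret X: sasakian_chart_pair "chart_img M i" "g1 i" "D1 i" "\<xi>1 i" c1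
    "chart_img N j" "g2 j" "D2 j" "\<xi>2 j" c2 by (rule chart_pair[OF ij])
  show "smooth_on (chart_img M i \<times> chart_img N j) (\<lambda>p. X.g p u v)" for u v
    by (rule X.P.smooth_g)
  fix p assume p: "p \<in> chart_img M i \<times> chart_img N j"
  show "bilinear (X.g p)" "X.g p u v = X.g p v u" "u \<noteq> 0 \<Longrightarrow> 0 < X.g p u u" for u v
    using X.P.bilinear_g[OF p] X.P.g_sym[OF p] X.P.g_pos[OF p] by auto
next
  fix i j i' j' p u v
  assume c: "i \<in> charts M" "j \<in> charts N" "i' \<in> charts M" "j' \<in> charts N"
    and p: "p \<in> overlap M i i' \<times> overlap N j j'"
  show "pair_metric (g1 i') (g2 j') (trans_map MN (i, j) (i', j') p)
      (ddir (trans_map MN (i, j) (i', j')) p u) (ddir (trans_map MN (i, j) (i', j')) p v) =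
      pair_metric (g1 i) (g2 j) p u v"
    using g1 g2 c p unfolding trans_map_product[OF M N c(1,2) p] ddir_trans_map_product[OF M N c p]
    by (auto simp: riemannian_metric_def pair_metric_def mem_Times_iff)
qed

lemma K_eq:
  assumes "i \<in> charts M" "j \<in> charts N" "p \<in> chart_img M i \<times> chart_img N j"
  shows "K (i, j) p = sasakian_chart_pair.J (g1 i) (D1 i) (\<xi>1 i) c1 (g2 j) (D2 j) (\<xi>2 j) c2 p"
  by (rule sasakian_chart_pair.standard_J_eq[OF chart_pair[OF assms(1,2)] assms(3)]) simp_all

lemma endomorphism_field_K: "endomorphism_field MN K"
  unfolding endomorphism_field_def ball_charts chart_img_product overlap_product
proof (intro conjI ballI allI impI)
  fix i j assume ij: "i \<in> charts M" "j \<in> charts N"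
  interpret X: sasakian_chart_pair "chart_img M i" "g1 i" "D1 i" "\<xi>1 i" c1
    "chart_img N j" "g2 j" "D2 j" "\<xi>2 j" c2 by (rule chart_pair[OF ij])
  show "smooth_on (chart_img M i \<times> chart_img N j) (\<lambda>p. K (i, j) p u)" for u
    using X.smooth_J[of u]
    by (subst smooth_on_cong[OF X.P.open_S, where g = "\<lambda>p. X.J p u"]) (simp_all add: K_eq[OF ij])
  show "linear (K (i, j) p)" if "p \<in> chart_img M i \<times> chart_img N j" for p
    using X.linear_J[OF that] by (simp only: K_eq[OF ij that])
next
  fix i j i' j' p u
  assume c: "i \<in> charts M" "j \<in> charts N" "i' \<in> charts M" "j' \<in> charts N"
    and p: "p \<in> overlap M i i' \<times> overlap N j j'"
  interpret X: sasakian_chart_pair "chart_img M i" "g1 i" "D1 i" "\<xi>1 i" c1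
    "chart_img N j" "g2 j" "D2 j" "\<xi>2 j" c2 by (rule chart_pair[OF c(1,2)])
  interpret X': sasakian_chart_pair "chart_img M i'" "g1 i'" "D1 i'" "\<xi>1 i'" c1
    "chart_img N j'" "g2 j'" "D2 j'" "\<xi>2 j'" c2 by (rule chart_pair[OF c(3,4)])
  have p1: "fst p \<in> overlap M i i'" and p2: "snd p \<in> overlap N j j'" using p by auto
  have "p \<in> chart_img M i \<times> chart_img N j"
    using p1 p2 overlap_subset[of M i i'] overlap_subset[of N j j'] by (auto simp: mem_Times_iff)
  moreover have "(trans_map M i i' (fst p), trans_map N j j' (snd p)) \<in> chart_img M i' \<times> chart_img N j'"
    using trans_map_in_img[OF M c(1,3) p1] trans_map_in_img[OF N c(2,4) p2] by simp
  moreover note l1 = linear_ddir[OF smooth_on_differentiable[OF trans_map_smooth[OF M c(1,3)] p1]]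
    and l2 = linear_ddir[OF smooth_on_differentiable[OF trans_map_smooth[OF N c(2,4)] p2]]
  ultimately show "K (i', j') (trans_map MN (i, j) (i', j') p) (ddir (trans_map MN (i, j) (i', j')) p u) =
      ddir (trans_map MN (i, j) (i', j')) p (K (i, j) p u)"
    unfolding trans_map_product[OF M N c(1,2) p] ddir_trans_map_product[OF M N c p]
    by (simp add: K_eq c X.J_def X'.J_def X.C1.\<eta>_def X'.C1.\<eta>_def X.C2.\<eta>_def X'.C2.\<eta>_def
        reeb_endo_trans[OF s1 c(1,3) p1] reeb_endo_trans[OF s2 c(2,4) p2]
        metric_trans[OF s1 c(1,3) p1] metric_trans[OF s2 c(2,4) p2]
        reeb_trans[OF s1 c(1,3) p1] reeb_trans[OF s2 c(2,4) p2]
        linear_add[OF l1] linear_diff[OF l1] linear_scale[OF l1]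
        linear_add[OF l2] linear_diff[OF l2] linear_scale[OF l2])
qed

lemma hermitian_product: "hermitian_manifold MN G K"
  unfolding hermitian_manifold_def ball_charts chart_img_product product_metric_eq
proof (intro conjI ballI allI smooth_manifold_product[OF M N] riemannian_metric_product
    endomorphism_field_K)
  fix i j p u v
  assume ij: "i \<in> charts M" "j \<in> charts N" and p: "p \<in> chart_img M i \<times> chart_img N j"
  interpret X: sasakian_chart_pair "chart_img M i" "g1 i" "D1 i" "\<xi>1 i" c1
    "chart_img N j" "g2 j" "D2 j" "\<xi>2 j" c2 by (rule chart_pair[OF ij])
  show "K (i, j) p (K (i, j) p u) = - u" unfolding K_eq[OF ij p] by (rule X.J_J[OF p])
  show "X.g p (K (i, j) p u) (K (i, j) p v) = X.g p u v"
    unfolding K_eq[OF ij p] by (rule X.g_J[OF p])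
  show "nijenhuis K (i, j) p u v = 0" by (rule X.nijenhuis_J[where K = K and i = "(i, j)", OF p K_eq[OF ij]])
qed

lemma affine_connection_product: "affine_connection MN B"
  unfolding affine_connection_def ball_charts chart_img_product overlap_product B_def prod.case
proof (intro conjI ballI allI impI)
  fix i j assume ij: "i \<in> charts M" "j \<in> charts N"
  interpret X: sasakian_chart_pair "chart_img M i" "g1 i" "D1 i" "\<xi>1 i" c1
    "chart_img N j" "g2 j" "D2 j" "\<xi>2 j" c2 by (rule chart_pair[OF ij])
  show "bilinear (X.\<Gamma> p)" if "p \<in> chart_img M i \<times> chart_img N j" for p
    by (rule X.P.bilinear_\<Gamma>[OF that])
  show "smooth_on (chart_img M i \<times> chart_img N j) (\<lambda>p. X.\<Gamma> p u v)" for u v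
    by (rule X.P.smooth_\<Gamma>)
next
  fix i j i' j' p u v
  assume c: "i \<in> charts M" "j \<in> charts N" "i' \<in> charts M" "j' \<in> charts N"
    and p: "p \<in> overlap M i i' \<times> overlap N j j'"
  have p1: "fst p \<in> overlap M i i'" and p2: "snd p \<in> overlap N j j'" using p by auto
  show "ddir (trans_map MN (i, j) (i', j')) p (pair_conn (B1 i) (B2 j) p u v) =
      ddir (\<lambda>q. ddir (trans_map MN (i, j) (i', j')) q v) p u +
      pair_conn (B1 i') (B2 j') (trans_map MN (i, j) (i', j') p)
        (ddir (trans_map MN (i, j) (i', j')) p u) (ddir (trans_map MN (i, j) (i', j')) p v)"
    unfolding trans_map_product[OF M N c(1,2) p] ddir_trans_map_product[OF M N c p]
      ddir_ddir_trans_map_product[OF M N c p]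
    by (simp add: pair_conn_def char_conn_trans[OF s1 c(1,3) p1] char_conn_trans[OF s2 c(2,4) p2])
qed

lemma ddir_K:
  assumes ij: "i \<in> charts M" "j \<in> charts N" and p: "p \<in> chart_img M i \<times> chart_img N j"
  shows "ddir (\<lambda>q. K (i, j) q v) p u = K (i, j) p (B (i, j) p u v) - B (i, j) p u (K (i, j) p v)"
proof -
  interpret X: sasakian_chart_pair "chart_img M i" "g1 i" "D1 i" "\<xi>1 i" c1
    "chart_img N j" "g2 j" "D2 j" "\<xi>2 j" c2 by (rule chart_pair[OF ij])
  have "ddir (\<lambda>q. K (i, j) q v) p = ddir (\<lambda>q. X.J q v) p"
    by (rule ddir_cong_open[OF X.P.open_S p]) (simp add: K_eq[OF ij])
  then show ?thesis using X.J_parallel[OF p, of v u] by (simp add: B_def K_eq[OF ij p])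
qed

lemma strominger_product: "strominger_connection MN G K B"
  unfolding strominger_connection_def metric_connection_def parallel_endo_def ball_charts
    chart_img_product product_metric_eq torsion_eq cov_def
proof (intro conjI ballI allI affine_connection_product)
  fix i j p u v w
  assume ij: "i \<in> charts M" "j \<in> charts N" and p: "p \<in> chart_img M i \<times> chart_img N j"
  interpret X: sasakian_chart_pair "chart_img M i" "g1 i" "D1 i" "\<xi>1 i" c1
    "chart_img N j" "g2 j" "D2 j" "\<xi>2 j" c2 by (rule chart_pair[OF ij])
  show "ddir (\<lambda>q. X.g q v w) p u = X.g p (ddir (\<lambda>_. v) p u + B (i, j) p u v) w +
      X.g p v (ddir (\<lambda>_. w) p u + B (i, j) p u w)"
    using X.P.ddir_g[OF p] by (simp add: B_def)
  show "ddir (\<lambda>q. K (i, j) q v) p u + B (i, j) p u (K (i, j) p v) =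
      K (i, j) p (ddir (\<lambda>_. v) p u + B (i, j) p u v)"
    by (simp add: ddir_K[OF ij p])
  show "X.g p (B (i, j) p u v - B (i, j) p v u) w = - X.g p (B (i, j) p u w - B (i, j) p w u) v"
    using X.T_skew[OF p, of u v w] by (simp add: B_def X.P.T_def)
  show "X.g p (B (i, j) p u v - B (i, j) p v u) w = - X.g p (B (i, j) p v u - B (i, j) p u v) w"
    using p by (simp add: X.P.g_simps)
qed

text \<open>\<open>strominger_kahler_like\<close> supplies an arbitrary D, constrained only on chart
  images; there it must be the explicit connection.\<close>

lemma strominger_eq_B:
  assumes D: "strominger_connection MN G K D"
    and ij: "i \<in> charts M" "j \<in> charts N" and p: "p \<in> chart_img M i \<times> chart_img N j"
  shows "D (i, j) p u v = B (i, j) p u v"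
proof -
  interpret X: sasakian_chart_pair "chart_img M i" "g1 i" "D1 i" "\<xi>1 i" c1
    "chart_img N j" "g2 j" "D2 j" "\<xi>2 j" c2 by (rule chart_pair[OF ij])
  have k: "(i, j) \<in> charts MN" and p': "p \<in> chart_img MN (i, j)"
    using ij p by (auto simp: charts_product chart_img_product)
  have "metric_chart (chart_img MN (i, j)) (G (i, j)) (D (i, j))"
    by (rule metric_chart_manifold[OF smooth_manifold_product[OF M N] riemannian_metric_product _ _ k])
      (use D in \<open>auto simp: strominger_connection_def\<close>)
  then have "metric_chart (chart_img M i \<times> chart_img N j) X.g (D (i, j))"
    by (simp add: chart_img_product product_metric_eq)
  then show ?thesis
  proof (rule strominger_unique[where J = "K (i, j)" and x = p])
    show "metric_chart (chart_img M i \<times> chart_img N j) X.g (B (i, j))"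
      using X.P.metric_chart_axioms by (simp add: B_def)
    show "ddir (\<lambda>q. K (i, j) q v) p u = K (i, j) p (D (i, j) p u v) - D (i, j) p u (K (i, j) p v)" for u v
      by (rule parallel_endo_ddir[OF _ k p']) (use D in \<open>simp add: strominger_connection_def\<close>)
    show "X.g p (D (i, j) p u v - D (i, j) p v u) w = - X.g p (D (i, j) p u w - D (i, j) p w u) v" for u v w
      using D k p' unfolding strominger_connection_def torsion_eq by (metis product_metric_eq)
    show "X.g p (B (i, j) p u v - B (i, j) p v u) w = - X.g p (B (i, j) p u w - B (i, j) p w u) v" for u v w
      using X.T_skew[OF p, of u v w] by (simp add: B_def X.P.T_def)
    show "K (i, j) p (K (i, j) p u) = - u" "X.g p (K (i, j) p u) (K (i, j) p v) = X.g p u v" for u v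
      unfolding K_eq[OF ij p] by (rule X.J_J[OF p] X.g_J[OF p])+
    show "linear (K (i, j) p)" using X.linear_J[OF p] by (simp add: K_eq[OF ij p])
  qed (rule p ddir_K[OF ij p])+
qed

text \<open>Equality with the explicit connection on an open set also identifies the derivatives of
  the Christoffel symbols, hence the curvatures.\<close>

lemma curvature_cyclic:
  assumes D: "strominger_connection MN G K D"
    and ij: "i \<in> charts M" "j \<in> charts N" and p: "p \<in> chart_img M i \<times> chart_img N j"
  defines "A1 \<equiv> char_tensor c1 (g1 i) (D1 i) (\<xi>1 i) (fst p)"
    and "A2 \<equiv> char_tensor c2 (g2 j) (D2 j) (\<xi>2 j) (snd p)"
  shows "curvature D (i, j) p u v w + curvature D (i, j) p v w u + curvature D (i, j) p w u v =
    4 *\<^sub>R (A1 (A1 (fst u) (fst v)) (fst w) + A1 (A1 (fst v) (fst w)) (fst u) + A1 (A1 (fst w) (fst u)) (fst v),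
      A2 (A2 (snd u) (snd v)) (snd w) + A2 (A2 (snd v) (snd w)) (snd u) + A2 (A2 (snd w) (snd u)) (snd v))"
proof -
  interpret X: sasakian_chart_pair "chart_img M i" "g1 i" "D1 i" "\<xi>1 i" c1
    "chart_img N j" "g2 j" "D2 j" "\<xi>2 j" c2 by (rule chart_pair[OF ij])
  have k: "(i, j) \<in> charts MN"
    using ij by (auto simp: charts_product)
  have "metric_chart (chart_img MN (i, j)) (G (i, j)) (D (i, j))"
    by (rule metric_chart_manifold[OF smooth_manifold_product[OF M N] riemannian_metric_product _ _ k])
      (use D in \<open>auto simp: strominger_connection_def\<close>)
  then interpret Y: metric_chart "chart_img M i \<times> chart_img N j" X.g "D (i, j)"
    by (simp add: chart_img_product product_metric_eq)
  have DB: "D (i, j) q u v = X.\<Gamma> q u v" if "q \<in> chart_img M i \<times> chart_img N j" for q u v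
    using strominger_eq_B[OF D ij that] by (simp add: B_def)
  have "ddir (\<lambda>q. D (i, j) q u v) p = ddir (\<lambda>q. X.\<Gamma> q u v) p" for u v
    by (rule ddir_cong_open[OF X.P.open_S p]) (rule DB)
  then have "curvature D (i, j) p u v w = X.P.R p u v w" for u v w
    unfolding Y.curvature_R[of D "(i, j)", OF refl p] by (simp add: Y.R_def X.P.R_def DB[OF p])
  then show ?thesis unfolding A1_def A2_def by (simp only: X.R_cyclic_A[OF p])
qed

lemma obtain_chart_point:
  obtains i j p where "i \<in> charts M" "j \<in> charts N" "p \<in> chart_img M i \<times> chart_img N j"
proof -
  obtain i a j b where "i \<in> charts M" "a \<in> chart_dom M i" "j \<in> charts N" "b \<in> chart_dom N j"
    using M N by (auto simp: smooth_manifold_def points_def)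
  then show ?thesis using that[of i j "(chart_map M i a, chart_map N j b)"] by (auto simp: chart_img_def)
qed

lemma strominger_kahler_like_iff_dim:
  "strominger_kahler_like MN G K \<longleftrightarrow> DIM('e) \<le> 3 \<and> DIM('f) \<le> 3"
proof
  assume "strominger_kahler_like MN G K"
  then obtain D where D: "strominger_connection MN G K D"
    and cyc: "\<And>k p x y z w. k \<in> charts MN \<Longrightarrow> p \<in> chart_img MN k \<Longrightarrow>
      G k p (curvature D k p x y z) w + G k p (curvature D k p y z x) w +
      G k p (curvature D k p z x y) w = 0"
    unfolding strominger_kahler_like_def Let_def by blast
  \<comment> \<open>A single point suffices: on a factor of dimension above 3 the obstruction is
    nonzero at every point.\<close>
  obtain i j p where ij: "i \<in> charts M" "j \<in> charts N" and p: "p \<in> chart_img M i \<times> chart_img N j"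
    by (rule obtain_chart_point)
  interpret X: sasakian_chart_pair "chart_img M i" "g1 i" "D1 i" "\<xi>1 i" c1
    "chart_img N j" "g2 j" "D2 j" "\<xi>2 j" c2 by (rule chart_pair[OF ij])
  have "curvature D (i, j) p u v w + curvature D (i, j) p v w u + curvature D (i, j) p w u v = 0" for u v w
    using cyc[of "(i, j)" p u v w] ij p
    by (intro X.P.g_eqI[OF p]) (simp add: charts_product chart_img_product product_metric_eq X.P.g_simps)
  note zero = this[unfolded curvature_cyclic[OF D ij p]]
  \<comment> \<open>Vectors tangent to one factor isolate its component of the cyclic sum.\<close>
  have "X.C1.A (fst p) (X.C1.A (fst p) u v) w + X.C1.A (fst p) (X.C1.A (fst p) v w) u +
      X.C1.A (fst p) (X.C1.A (fst p) w u) v = 0" for u v w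
    using zero[of "(u, 0)" "(v, 0)" "(w, 0)"] by (simp add: prod_eq_iff)
  then have "\<not> 3 < DIM('e)" using X.C1.A_cyclic_nonzero[of "fst p"] p by (metis mem_Times_iff)
  moreover have "X.C2.A (snd p) (X.C2.A (snd p) u v) w + X.C2.A (snd p) (X.C2.A (snd p) v w) u +
      X.C2.A (snd p) (X.C2.A (snd p) w u) v = 0" for u v w
    using zero[of "(0, u)" "(0, v)" "(0, w)"] by (simp add: prod_eq_iff)
  then have "\<not> 3 < DIM('f)" using X.C2.A_cyclic_nonzero[of "snd p"] p by (metis mem_Times_iff)
  ultimately show "DIM('e) \<le> 3 \<and> DIM('f) \<le> 3" by simp
next
  assume dim: "DIM('e) \<le> 3 \<and> DIM('f) \<le> 3"
  show "strominger_kahler_like MN G K"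
  proof (rule strominger_kahler_likeI[OF hermitian_product strominger_product])
    fix k p x y z assume "k \<in> charts MN" "p \<in> chart_img MN k"
    then obtain i j where k: "k = (i, j)" and ij: "i \<in> charts M" "j \<in> charts N"
      and p: "p \<in> chart_img M i \<times> chart_img N j"
      by (cases k) (auto simp: charts_product chart_img_product)
    interpret X: sasakian_chart_pair "chart_img M i" "g1 i" "D1 i" "\<xi>1 i" c1
      "chart_img N j" "g2 j" "D2 j" "\<xi>2 j" c2 by (rule chart_pair[OF ij])
    have p': "fst p \<in> chart_img M i" "snd p \<in> chart_img N j" using p by auto
    show "curvature B k p x y z + curvature B k p y z x + curvature B k p z x y = 0"
      unfolding k curvature_cyclic[OF strominger_product ij p]
      using dim by (simp add: X.C1.A_cyclic_dim_le_3[OF p'(1)] X.C2.A_cyclic_dim_le_3[OF p'(2)] prod_eq_iff)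
  qed
qed

end

theorem corollary6:
  fixes N1 :: "('i, 'a::{t2_space,second_countable_topology}, 'e::euclidean_space) atlas"
    and N2 :: "('j, 'b::{t2_space,second_countable_topology}, 'f::euclidean_space) atlas"
    and g1 :: "('i, 'e) metric" and g2 :: "('j, 'f) metric"
    and D1 :: "('i, 'e) connection" and D2 :: "('j, 'f) connection"
    and \<xi>1 :: "('i, 'e) vec_field" and \<xi>2 :: "('j, 'f) vec_field"
    and c1 c2 :: real and n1 n2 :: nat
  assumes "sasakian n1 c1 N1 g1 D1 \<xi>1"
    and "sasakian n2 c2 N2 g2 D2 \<xi>2"
    and "n1 + n2 + 1 \<ge> 2"
  shows "strominger_kahler_like (product_atlas N1 N2) (product_metric g1 g2)
           (standard_J c1 c2 g1 g2 D1 D2 \<xi>1 \<xi>2)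
         \<longleftrightarrow> n1 \<le> 1 \<and> n2 \<le> 1"
proof -
  interpret sasakian_product N1 N2 g1 g2 D1 D2 \<xi>1 \<xi>2 c1 c2 n1 n2
    using assms by unfold_locales
  \<comment> \<open>The bound 3 on the dimension 2n + 1 means n at most 1.\<close>
  have "DIM('e) = 2 * n1 + 1" "DIM('f) = 2 * n2 + 1"
    using assms by (auto simp: sasakian_def)
  then show ?thesis unfolding strominger_kahler_like_iff_dim by auto
qed

end
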